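(* Any symbol $u\in\mathrm{BMOA}_{\mathrm{simp}}(\mathbb T)$ is uniquely determined by its spectral datum $\Lambda(u)=(\rho,\Psi_u,\widetilde\Psi_u)$; i.e. the spectral map $$\mathrm{BMOA}_{\mathrm{simp}}(\mathbb T)\ni u\mapsto \Lambda(u)=(\rho,\Psi_u,\widetilde\Psi_u)$$ is injective.
   Context: $H^2=H^2(\mathbb T)$ is the Hardy space on the unit circle, $P:L^2(\mathbb T)\to H^2$ is the orthogonal projection, $S$ is the shift $Sf(z)=zf(z)$ on $H^2$. For $u\in\mathrm{BMOA}(\mathbb T)$, $H_u$ is the bounded anti-linear Hankel operator on $H^2$, $H_uf=P(u\overline f)$ (initially on polynomials $f$), and $\widetilde H_u:=S^*H_u=H_uS=H_{S^*u}$. The operators $H_u^2,\widetilde H_u^2$ are linear and positive semi-definite; $|H_u|:=(H_u^2)^{1/2}$, $|\widetilde H_u|:=(\widetilde H_u^2)^{1/2}$. The subspace $\overline{\mathrm{Ran}}\,H_u$ (closure of the range) is invariant under $H_u$ and $\widetilde H_u$; let $H_u^{\mathrm e}$, $\widetilde H_u^{\mathrm e}$ be the restrictions of $H_u$, $\widetilde H_u$ to $\overline{\mathrm{Ran}}\,H_u$. $\mathrm{BMOA}_{\mathrm{simp}}(\mathbb T)$ is the set of $u\in\mathrm{BMOA}(\mathbb T)$ such that both $(H_u^{\mathrm e})^2$ and $(\widetilde H_u^{\mathrm e})^2$ have simple spectra (i.e. possess a cyclic vector). Spectral datum. For $u\in\mathrm{BMOA}_{\mathrm{simp}}(\mathbb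 T)$ the vector $u$ lies in $\overline{\mathrm{Ran}}\,H_u$ and is cyclic for both $|H_u^{\mathrm e}|$ and $|\widetilde H_u^{\mathrm e}|$. Let $\rho$ and $\widetilde\rho$ be the spectral measures of $|H_u|$ and $|\widetilde H_u|$ corresponding to the vector $u$: $\int f\,d\rho=\langle f(|H_u|)u,u\rangle$, $\int f\,d\widetilde\rho=\langle f(|\widetilde H_u|)u,u\rangle$ for continuous $f$. Here $\rho$ is a finite measure with bounded support, carried by $(0,\infty)$, and $\widetilde\rho$ is carried by $[0,\infty)$ (it is determined by $\rho$); put $\widetilde\rho_0=\widetilde\rho|_{(0,\infty)}$. There exist unimodular functions $\Psi_u$, unique in $L^\infty(\rho)$, and $\widetilde\Psi_u$, unique in $L^\infty(\widetilde\rho_0)$, such that $$H_u^{\mathrm e}f(|H_u^{\mathrm e}|)u=|H_u^{\mathrm e}|\,\overline{\Psi_u}(|H_u^{\mathrm e}|)\,\overline f(|H_u^{\mathrm e}|)u,\quad f\in L^2(\rho),$$ $$\widetilde H_u^{\mathrm e}f(|\widetilde H_u^{\mathrm e}|)u=|\widetilde H_u^{\mathrm e}|\,\widetilde\Psi_u(|\widetilde H_u^{\mathrm e}|)\,\overline f(|\widetilde H_u^{\mathrm e}|)u,\quad f\in L^2(\widetilde\rho).$$ (The value $\widetilde\Psi_u(0)$ is irrelevant.) The spectral datum of $u$ is $\Lambda(u):=(\rho,\Psi_u,\widetilde\Psi_u)$. *)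

theory Defs
  imports "HOL-Analysis.Analysis" "HOL-Computational_Algebra.Polynomial"
begin

section \<open>Complex inner product spaces\<close>

text \<open>
  The library only has real inner product spaces.  The complex structure is added on top of it;
  \<open>cinner\<close> is linear in its first argument.
\<close>

class complex_inner = real_inner +
  fixes scaleC :: "complex \<Rightarrow> 'a \<Rightarrow> 'a"  (infixr "*\<^sub>C" 75)
    and cinner :: "'a \<Rightarrow> 'a \<Rightarrow> complex"
  assumes scaleC_add_right: "c *\<^sub>C (x + y) = c *\<^sub>C x + c *\<^sub>C y"
    and scaleC_add_left: "(c + d) *\<^sub>C x = c *\<^sub>C x + d *\<^sub>C x"
    and scaleC_scaleC: "c *\<^sub>C d *\<^sub>C x = (c * d) *\<^sub>C x"
    and scaleC_one: "1 *\<^sub>C x = x"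
    and scaleR_scaleC: "r *\<^sub>R x = of_real r *\<^sub>C x"
    and cinner_commute: "cinner x y = cnj (cinner y x)"
    and cinner_add_left: "cinner (x + y) z = cinner x z + cinner y z"
    and cinner_scaleC_left: "cinner (c *\<^sub>C x) y = c * cinner x y"
    and inner_eq_Re_cinner: "inner x y = Re (cinner x y)"

definition bounded_clinear :: "('a::complex_inner \<Rightarrow> 'b::complex_inner) \<Rightarrow> bool" where
  "bounded_clinear A \<longleftrightarrow> bounded_linear A \<and> (\<forall>c x. A (c *\<^sub>C x) = c *\<^sub>C A x)"

definition bounded_antilinear :: "('a::complex_inner \<Rightarrow> 'b::complex_inner) \<Rightarrow> bool" where
  "bounded_antilinear A \<longleftrightarrow> bounded_linear A \<and> (\<forall>c x. A (c *\<^sub>C x) = cnj c *\<^sub>C A x)"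


section \<open>Square roots, functional calculus, spectral measures\<close>

definition psd :: "('a::complex_inner \<Rightarrow> 'a) \<Rightarrow> bool" where
  "psd A \<longleftrightarrow> bounded_clinear A \<and> (\<forall>x. cinner (A x) x \<in> \<real>\<^sub>\<ge>\<^sub>0)"

text \<open>\<open>is_modulus H A\<close> says \<open>A = (H\<^sup>2)\<^sup>1\<^sup>/\<^sup>2\<close>, the positive semi-definite square root.\<close>

definition is_modulus :: "('a::complex_inner \<Rightarrow> 'a) \<Rightarrow> ('a \<Rightarrow> 'a) \<Rightarrow> bool" where
  "is_modulus H A \<longleftrightarrow> psd A \<and> A \<circ> A = H \<circ> H"

definition poly_op :: "('a::complex_inner \<Rightarrow> 'a) \<Rightarrow> complex poly \<Rightarrow> 'a \<Rightarrow> 'a" where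
  "poly_op A p x = (\<Sum>i\<le>degree p. coeff p i *\<^sub>C (A ^^ i) x)"

text \<open>
  The restriction of \<open>A\<close> to the closed invariant subspace \<open>K\<close> has simple spectrum: some
  \<open>w \<in> K\<close> is cyclic, i.e. \<open>w, A w, A\<^sup>2 w, \<dots>\<close> have dense complex linear span in \<open>K\<close>.
\<close>

definition simple_spectrum_on :: "'a::complex_inner set \<Rightarrow> ('a \<Rightarrow> 'a) \<Rightarrow> bool" where
  "simple_spectrum_on K A \<longleftrightarrow> (\<exists>w\<in>K. closure (range (\<lambda>p. poly_op A p w)) = K)"

text \<open>
  Continuous functional calculus \<open>B = f(A)\<close> of a positive semi-definite \<open>A\<close>, whose spectrum lies
  in \<open>[0, \<parallel>A\<parallel>]\<close>: \<open>f(A)\<close> is the limit in operator norm of \<open>p\<^sub>n(A)\<close> whenever the polynomials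
  \<open>p\<^sub>n\<close> converge to \<open>f\<close> uniformly on that interval.  Such \<open>p\<^sub>n\<close> exist only for \<open>f\<close>
  continuous there, so the notion is meaningful (and is used) only for continuous \<open>f\<close>.
\<close>

definition is_cont_calculus ::
  "('a::complex_inner \<Rightarrow> 'a) \<Rightarrow> (real \<Rightarrow> complex) \<Rightarrow> ('a \<Rightarrow> 'a) \<Rightarrow> bool" where
  "is_cont_calculus A f B \<longleftrightarrow> bounded_clinear B \<and>
     (\<forall>p :: nat \<Rightarrow> complex poly.
        uniform_limit {0..onorm A} (\<lambda>n s. poly (p n) (of_real s)) f sequentially \<longrightarrow>
        (\<lambda>n. onorm (\<lambda>x. poly_op A (p n) x - B x)) \<longlonglongrightarrow> 0)"

definition is_spectral_measure ::
  "('a::complex_inner \<Rightarrow> 'a) \<Rightarrow> 'a \<Rightarrow> real measure \<Rightarrow> bool" where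
  "is_spectral_measure A u \<mu> \<longleftrightarrow> finite_measure \<mu> \<and> sets \<mu> = sets borel \<and>
     (\<forall>f. continuous_on UNIV f \<longrightarrow>
        (\<exists>B. is_cont_calculus A f B \<and> has_bochner_integral \<mu> f (cinner (B u) u)))"

definition square_integrable :: "'a measure \<Rightarrow> ('a \<Rightarrow> complex) \<Rightarrow> bool" where
  "square_integrable M f \<longleftrightarrow> f \<in> borel_measurable M \<and> integrable M (\<lambda>x. (cmod (f x))\<^sup>2)"

text \<open>
  The vector \<open>y = f(A)u\<close> for \<open>f \<in> L\<^sup>2(\<mu>)\<close>, where \<open>\<mu>\<close> is the spectral measure of \<open>A\<close> for \<open>u\<close>:
  the continuous extension to \<open>L\<^sup>2(\<mu>)\<close> of the isometry \<open>g \<mapsto> g(A)u\<close> on continuous \<open>g\<close>.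
\<close>

definition is_L2_calculus ::
  "('a::complex_inner \<Rightarrow> 'a) \<Rightarrow> 'a \<Rightarrow> real measure \<Rightarrow> (real \<Rightarrow> complex) \<Rightarrow> 'a \<Rightarrow> bool" where
  "is_L2_calculus A u \<mu> f y \<longleftrightarrow>
     (\<exists>(g :: nat \<Rightarrow> real \<Rightarrow> complex) (G :: nat \<Rightarrow> 'a \<Rightarrow> 'a).
        (\<forall>n. continuous_on UNIV (g n) \<and> is_cont_calculus A (g n) (G n)) \<and>
        (\<lambda>n. \<integral>\<^sup>+ s. ennreal ((cmod (g n s - f s))\<^sup>2) \<partial>\<mu>) \<longlonglongrightarrow> 0 \<and>
        (\<lambda>n. G n u) \<longlonglongrightarrow> y)"


section \<open>The space \<open>L\<^sup>2\<close> of the unit circle\<close>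

definition circle :: "complex measure" where
  "circle = distr (uniform_measure lborel {0..<2*pi}) borel cis"

lemma sets_circle [measurable_cong, simp]: "sets circle = sets borel"
  and space_circle [simp]: "space circle = UNIV"
  by (simp_all add: circle_def)

lemma borel_measurable_cis [measurable]: "cis \<in> borel_measurable borel"
  by (intro borel_measurable_continuous_onI continuous_intros)

lemma borel_measurable_cnj' [measurable (raw)]:
  fixes f :: "'a \<Rightarrow> complex"
  assumes "f \<in> borel_measurable M" shows "(\<lambda>x. cnj (f x)) \<in> borel_measurable M"
proof -
  have "cnj \<in> borel_measurable borel"
    using continuous_on_cnj[OF continuous_on_id] by (intro borel_measurable_continuous_onI) simp
  then show ?thesis
    using assms by (rule measurable_compose_rev)
qed

lemma emeasure_circle: "emeasure circle UNIV = 1"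
proof -
  have "emeasure circle UNIV = emeasure (uniform_measure lborel {0..<2*pi}) UNIV"
    unfolding circle_def by (subst emeasure_distr) auto
  also have "\<dots> = 1"
    using emeasure_uniform_measure_1[of lborel "{0..<2*pi}"]
      emeasure_uniform_measure[of "{0..<2*pi}" lborel UNIV] by (simp add: ennreal_divide_self)
  finally show ?thesis .
qed

interpretation circle: finite_measure circle
  by (rule finite_measureI) (simp add: emeasure_circle)

lemma AE_circle: "AE z in circle. cmod z = 1"
  unfolding circle_def by (subst AE_distr_iff) auto

lemma square_integrable_cmult:
  assumes "square_integrable M f" shows "square_integrable M (\<lambda>x. c * f x)"
  using assms by (auto simp: square_integrable_def norm_mult power_mult_distrib)

lemma square_integrable_add:
  assumes "square_integrable M f" "square_integrable M g"
  shows "square_integrable M (\<lambda>x. f x + g x)"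
proof -
  have [measurable]: "f \<in> borel_measurable M" "g \<in> borel_measurable M"
    using assms by (auto simp: square_integrable_def)
  have *: "(cmod (f x + g x))\<^sup>2 \<le> 2 * (cmod (f x))\<^sup>2 + 2 * (cmod (g x))\<^sup>2" for x
  proof -
    have "(cmod (f x + g x))\<^sup>2 \<le> (cmod (f x) + cmod (g x))\<^sup>2"
      by (intro power_mono norm_triangle_ineq) auto
    also have "\<dots> \<le> 2 * (cmod (f x))\<^sup>2 + 2 * (cmod (g x))\<^sup>2"
      using sum_squares_bound[of "cmod (f x)" "cmod (g x)"] by (simp add: power2_sum)
    finally show ?thesis .
  qed
  have "integrable M (\<lambda>x. 2 * (cmod (f x))\<^sup>2 + 2 * (cmod (g x))\<^sup>2)"
    using assms by (auto simp: square_integrable_def)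
  then have "integrable M (\<lambda>x. (cmod (f x + g x))\<^sup>2)"
    by (rule Bochner_Integration.integrable_bound) (use * in auto)
  then show ?thesis by (simp add: square_integrable_def)
qed

lemma square_integrable_mult_cnj:
  assumes "square_integrable M f" "square_integrable M g"
  shows "integrable M (\<lambda>x. f x * cnj (g x))"
proof -
  have [measurable]: "f \<in> borel_measurable M" "g \<in> borel_measurable M"
    using assms by (auto simp: square_integrable_def)
  have *: "cmod (f x * cnj (g x)) \<le> (cmod (f x))\<^sup>2 + (cmod (g x))\<^sup>2" for x
  proof -
    have "0 \<le> cmod (f x) * cmod (g x)" by simp
    then show ?thesis
      using sum_squares_bound[of "cmod (f x)" "cmod (g x)"] unfolding norm_mult complex_mod_cnj
      by linarith
  qed
  have "integrable M (\<lambda>x. (cmod (f x))\<^sup>2 + (cmod (g x))\<^sup>2)"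
    using assms by (auto simp: square_integrable_def)
  then show ?thesis
    by (rule Bochner_Integration.integrable_bound) (use * in auto)
qed

lemma integral_mult_cnj_self:
  "(\<integral>x. f x * cnj (f x) \<partial>M) = complex_of_real (\<integral>x. (cmod (f x))\<^sup>2 \<partial>M)"
  unfolding complex_norm_square[symmetric] by (rule integral_complex_of_real)

definition l2_eq :: "(complex \<Rightarrow> complex) \<Rightarrow> (complex \<Rightarrow> complex) \<Rightarrow> bool" where
  "l2_eq f g \<longleftrightarrow> square_integrable circle f \<and> square_integrable circle g \<and>
     (AE z in circle. f z = g z)"

lemma part_equivp_l2_eq: "part_equivp l2_eq"
proof (rule part_equivpI)
  show "\<exists>x. l2_eq x x"
    by (intro exI[of _ "\<lambda>_. 0"]) (simp add: l2_eq_def square_integrable_def)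
  show "symp l2_eq" by (auto simp: symp_def l2_eq_def)
  show "transp l2_eq" by (auto simp: transp_def l2_eq_def)
qed

quotient_type l2_circle = "complex \<Rightarrow> complex" / partial: l2_eq
  morphisms l2_fun l2_of
  by (rule part_equivp_l2_eq)

instantiation l2_circle :: complex_inner
begin

lift_definition zero_l2_circle :: l2_circle is "\<lambda>_. 0"
  by (simp add: l2_eq_def square_integrable_def)

lift_definition plus_l2_circle :: "l2_circle \<Rightarrow> l2_circle \<Rightarrow> l2_circle" is "\<lambda>f g z. f z + g z"
  by (auto simp: l2_eq_def intro: square_integrable_add)

lift_definition scaleC_l2_circle :: "complex \<Rightarrow> l2_circle \<Rightarrow> l2_circle" is "\<lambda>c f z. c * f z"
  by (auto simp: l2_eq_def intro: square_integrable_cmult)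

lift_definition cinner_l2_circle :: "l2_circle \<Rightarrow> l2_circle \<Rightarrow> complex" is
  "\<lambda>f g. \<integral>z. f z * cnj (g z) \<partial>circle"
  by (rule integral_cong_AE) (auto simp: l2_eq_def square_integrable_def)

definition scaleR_l2_circle :: "real \<Rightarrow> l2_circle \<Rightarrow> l2_circle" where
  "scaleR_l2_circle r f = complex_of_real r *\<^sub>C f"

definition uminus_l2_circle :: "l2_circle \<Rightarrow> l2_circle" where
  "uminus_l2_circle f = (- 1) *\<^sub>C f"

definition minus_l2_circle :: "l2_circle \<Rightarrow> l2_circle \<Rightarrow> l2_circle" where
  "minus_l2_circle f g = f + - g"

definition inner_l2_circle :: "l2_circle \<Rightarrow> l2_circle \<Rightarrow> real" where
  "inner_l2_circle f g = Re (cinner f g)"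

definition norm_l2_circle :: "l2_circle \<Rightarrow> real" where
  "norm_l2_circle f = sqrt (inner f f)"

definition sgn_l2_circle :: "l2_circle \<Rightarrow> l2_circle" where
  "sgn_l2_circle f = inverse (norm f) *\<^sub>R f"

definition dist_l2_circle :: "l2_circle \<Rightarrow> l2_circle \<Rightarrow> real" where
  "dist_l2_circle f g = norm (f - g)"

definition uniformity_l2_circle :: "(l2_circle \<times> l2_circle) filter" where
  "uniformity_l2_circle = (INF e\<in>{0<..}. principal {(x, y). dist x y < e})"

definition open_l2_circle :: "l2_circle set \<Rightarrow> bool" where
  "open_l2_circle U \<longleftrightarrow> (\<forall>x\<in>U. \<forall>\<^sub>F (x', y) in uniformity. x' = x \<longrightarrow> y \<in> U)"

instance
proof
  fix x y z :: l2_circle and c d :: complex and r s :: real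
  show "x + y + z = x + (y + z)" 
    by transfer (auto simp: l2_eq_def add.assoc intro!: square_integrable_add)
  show "x + y = y + x"
    by transfer (auto simp: l2_eq_def add.commute intro!: square_integrable_add)
  show "0 + x = x"
    by transfer (auto simp: l2_eq_def)
  show "- x + x = 0" unfolding uminus_l2_circle_def
    by transfer (auto simp: l2_eq_def square_integrable_def)
  show "x - y = x + - y" by (simp add: minus_l2_circle_def)
  have C1: "c *\<^sub>C (x + y) = c *\<^sub>C x + c *\<^sub>C y" for c and x y :: l2_circle
    by transfer (auto simp: l2_eq_def ring_distribs intro!: square_integrable_add square_integrable_cmult)
  have C2: "(c + d) *\<^sub>C x = c *\<^sub>C x + d *\<^sub>C x" for c d and x :: l2_circle
    by transfer (auto simp: l2_eq_def ring_distribs intro!: square_integrable_add square_integrable_cmult)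
  have C3: "c *\<^sub>C d *\<^sub>C x = (c * d) *\<^sub>C x" for c d and x :: l2_circle
    by transfer (auto simp: l2_eq_def mult.assoc intro!: square_integrable_cmult)
  have C4: "1 *\<^sub>C x = x" for x :: l2_circle by transfer (auto simp: l2_eq_def)
  show "c *\<^sub>C (x + y) = c *\<^sub>C x + c *\<^sub>C y" "(c + d) *\<^sub>C x = c *\<^sub>C x + d *\<^sub>C x"
    "c *\<^sub>C d *\<^sub>C x = (c * d) *\<^sub>C x" "1 *\<^sub>C x = x"
    by (fact C1 C2 C3 C4)+
  show "r *\<^sub>R (x + y) = r *\<^sub>R x + r *\<^sub>R y" "(r + s) *\<^sub>R x = r *\<^sub>R x + s *\<^sub>R x"
    "r *\<^sub>R s *\<^sub>R x = (r * s) *\<^sub>R x" "1 *\<^sub>R x = x" "r *\<^sub>R x = complex_of_real r *\<^sub>C x"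
    unfolding scaleR_l2_circle_def by (simp_all add: C1 C2 C3 C4)
  have comm: "cinner x y = cnj (cinner y x)" for x y :: l2_circle
  proof transfer
    fix f g
    have "(\<integral>z. f z * cnj (g z) \<partial>circle) = (\<integral>z. cnj (g z * cnj (f z)) \<partial>circle)"
      by (simp add: mult.commute)
    also have "\<dots> = cnj (\<integral>z. g z * cnj (f z) \<partial>circle)"
      by (rule Bochner_Integration.integral_cnj)
    finally show "(\<integral>z. f z * cnj (g z) \<partial>circle) = cnj (\<integral>z. g z * cnj (f z) \<partial>circle)" .
  qed
  then show "cinner x y = cnj (cinner y x)" .
  have cinner_add_left': "cinner (x + y) z = cinner x z + cinner y z" for x y z :: l2_circle
    by transfer (auto simp: l2_eq_def ring_distribs square_integrable_mult_cnj
       intro!: Bochner_Integration.integral_add)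
  have cinner_scaleC_left': "cinner (c *\<^sub>C x) y = c * cinner x y" for c and x y :: l2_circle
    by transfer (simp add: mult.assoc)
  show "cinner (x + y) z = cinner x z + cinner y z" "cinner (c *\<^sub>C x) y = c * cinner x y"
    by (fact cinner_add_left' cinner_scaleC_left')+
  show "inner x y = Re (cinner x y)" by (simp add: inner_l2_circle_def)
  show "inner x y = inner y x"
    unfolding inner_l2_circle_def by (subst comm) simp
  show "inner (x + y) z = inner x z + inner y z" "inner (r *\<^sub>R x) y = r * inner x y"
    unfolding inner_l2_circle_def scaleR_l2_circle_def
    using cinner_add_left' cinner_scaleC_left' by simp_all
  have self: "cinner x x = of_real (\<integral>z. (cmod (l2_fun x z))\<^sup>2 \<partial>circle)"
    unfolding cinner_l2_circle.rep_eq by (simp add: integral_mult_cnj_self)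
  show "0 \<le> inner x x"
    unfolding inner_l2_circle_def self by simp
  show "inner x x = 0 \<longleftrightarrow> x = 0"
    unfolding inner_l2_circle_def
  proof transfer
    fix f assume f: "l2_eq f f"
    then have [measurable]: "f \<in> borel_measurable borel"
      by (auto simp: l2_eq_def square_integrable_def)
    have "Re (\<integral>z. f z * cnj (f z) \<partial>circle) = (\<integral>z. (cmod (f z))\<^sup>2 \<partial>circle)"
      by (simp add: integral_mult_cnj_self)
    also have "\<dots> = 0 \<longleftrightarrow> (AE z in circle. f z = 0)"
      using f by (subst integral_nonneg_eq_0_iff_AE) (auto simp: l2_eq_def square_integrable_def)
    also have "\<dots> \<longleftrightarrow> l2_eq f (\<lambda>_. 0)"
      using f by (auto simp: l2_eq_def square_integrable_def)
    finally show "Re (\<integral>z. f z * cnj (f z) \<partial>circle) = 0 \<longleftrightarrow> l2_eq f (\<lambda>_. 0)" .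
  qed
  show "norm x = sqrt (inner x x)" by (simp add: norm_l2_circle_def)
  show "sgn x = inverse (norm x) *\<^sub>R x" by (simp add: sgn_l2_circle_def)
  show "dist x y = norm (x - y)" by (simp add: dist_l2_circle_def)
  show "(uniformity :: (l2_circle \<times> l2_circle) filter) =
      (INF e\<in>{0<..}. principal {(x, y). dist x y < e})"
    by (simp add: uniformity_l2_circle_def)
  show "open U \<longleftrightarrow> (\<forall>x\<in>U. \<forall>\<^sub>F (x', y) in uniformity. x' = x \<longrightarrow> y \<in> U)" for U :: "l2_circle set"
    by (simp add: open_l2_circle_def)
qed

end

lemma square_integrable_bounded_mult:
  assumes "square_integrable circle f" "h \<in> borel_measurable borel"
    and "AE z in circle. cmod (h z) \<le> C"
  shows "square_integrable circle (\<lambda>z. h z * f z)"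
proof -
  have [measurable]: "f \<in> borel_measurable borel" "h \<in> borel_measurable borel"
    using assms by (auto simp: square_integrable_def)
  have "AE z in circle. norm ((cmod (h z * f z))\<^sup>2) \<le> norm (C\<^sup>2 * (cmod (f z))\<^sup>2)"
    using assms(3)
  proof eventually_elim
    case (elim z)
    then have "(cmod (h z))\<^sup>2 \<le> C\<^sup>2" by (intro power_mono) simp_all
    then have "(cmod (h z))\<^sup>2 * (cmod (f z))\<^sup>2 \<le> C\<^sup>2 * (cmod (f z))\<^sup>2"
      by (rule mult_right_mono) simp
    then show ?case by (simp add: norm_mult power_mult_distrib)
  qed
  moreover have "integrable circle (\<lambda>z. C\<^sup>2 * (cmod (f z))\<^sup>2)"
    using assms(1) by (simp add: square_integrable_def)
  moreover have "(\<lambda>z. (cmod (h z * f z))\<^sup>2) \<in> borel_measurable circle"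
    by measurable
  ultimately have "integrable circle (\<lambda>z. (cmod (h z * f z))\<^sup>2)"
    using Bochner_Integration.integrable_bound by blast
  then show ?thesis by (simp add: square_integrable_def)
qed

lemma square_integrable_circle_bounded:
  assumes "h \<in> borel_measurable borel" "AE z in circle. cmod (h z) \<le> C"
  shows "square_integrable circle h"
proof -
  have "square_integrable circle (\<lambda>_. 1)"
    by (simp add: square_integrable_def)
  from square_integrable_bounded_mult[OF this assms] show ?thesis by simp
qed

lemma borel_measurable_powi: "(\<lambda>z::complex. z powi n) \<in> borel_measurable borel"
  by (cases "n \<ge> 0") (simp_all add: power_int_def)

lemma borel_measurable_poly: "poly p \<in> borel_measurable borel" for p :: "complex poly"
  by (intro borel_measurable_continuous_onI continuous_intros)

lemma AE_circle_poly: "AE z in circle. cmod (poly p z) \<le> (\<Sum>i\<le>degree p. cmod (coeff p i))"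
  using AE_circle
proof eventually_elim
  case (elim z)
  then show ?case
    unfolding poly_altdef by (intro order_trans[OF norm_sum] sum_mono) (simp add: norm_mult norm_power)
qed

lift_definition l2_monom :: "int \<Rightarrow> l2_circle" is "\<lambda>n z. z powi n"
proof -
  fix n :: int
  have "AE z in circle. cmod (z powi n) \<le> 1"
    using AE_circle by eventually_elim (simp add: norm_power_int)
  then show "l2_eq (\<lambda>z. z powi n) (\<lambda>z. z powi n)"
    using square_integrable_circle_bounded[OF borel_measurable_powi] by (simp add: l2_eq_def)
qed

lift_definition l2_poly :: "complex poly \<Rightarrow> l2_circle" is "poly"
  using square_integrable_circle_bounded[OF borel_measurable_poly AE_circle_poly]
  by (simp add: l2_eq_def)

lift_definition l2_mult_z :: "l2_circle \<Rightarrow> l2_circle" is "\<lambda>f z. z * f z"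
proof -
  have "AE z in circle. cmod z \<le> 1"
    using AE_circle by eventually_elim simp
  then show "l2_eq (\<lambda>z. z * f z) (\<lambda>z. z * g z)" if "l2_eq f g" for f g
    using that by (auto simp: l2_eq_def intro!: square_integrable_bounded_mult[where h = "\<lambda>z. z"])
qed

lift_definition l2_mult_cnj_poly :: "l2_circle \<Rightarrow> complex poly \<Rightarrow> l2_circle" is
  "\<lambda>f p z. f z * cnj (poly p z)"
proof -
  fix f g and p :: "complex poly" assume fg: "l2_eq f g"
  have *: "(\<lambda>z. cnj (poly p z)) \<in> borel_measurable borel"
    by (rule borel_measurable_cnj'[OF borel_measurable_poly])
  have **: "AE z in circle. cmod (cnj (poly p z)) \<le> (\<Sum>i\<le>degree p. cmod (coeff p i))"
    using AE_circle_poly[of p] by simp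
  show "l2_eq (\<lambda>z. f z * cnj (poly p z)) (\<lambda>z. g z * cnj (poly p z))"
    using fg square_integrable_bounded_mult[OF _ * **, of f] square_integrable_bounded_mult[OF _ * **, of g]
    by (auto simp: l2_eq_def mult.commute)
qed

definition fourier_coeff :: "l2_circle \<Rightarrow> int \<Rightarrow> complex" where
  "fourier_coeff f n = cinner f (l2_monom n)"

lemma fourier_coeff_mult_z: "fourier_coeff (l2_mult_z f) n = fourier_coeff f (n - 1)"
  unfolding fourier_coeff_def
proof transfer
  fix f and n :: int assume "l2_eq f f"
  then have [measurable]: "f \<in> borel_measurable borel"
    by (auto simp: l2_eq_def square_integrable_def)
  note borel_measurable_powi[measurable]
  show "(\<integral>z. z * f z * cnj (z powi n) \<partial>circle) = (\<integral>z. f z * cnj (z powi (n - 1)) \<partial>circle)"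
  proof (rule integral_cong_AE)
    show "AE z in circle. z * f z * cnj (z powi n) = f z * cnj (z powi (n - 1))"
      using AE_circle
    proof eventually_elim
      case (elim z)
      then have z: "z \<noteq> 0" and zz: "z * cnj z = 1"
        by (auto simp: complex_norm_square[symmetric])
      have "z powi n = z * z powi (n - 1)"
        using power_int_add_1'[of z "n - 1"] z by simp
      then have "z * f z * cnj (z powi n) = (z * cnj z) * f z * cnj (z powi (n - 1))"
        by simp
      then show ?case using zz by simp
    qed
  qed measurable
qed

lemma integral_circle_power:
  assumes "k > 0" shows "(\<integral>z. z ^ k \<partial>circle) = 0"
proof -
  define F where "F = (\<lambda>t. exp (\<i> * real k * complex_of_real t) / (\<i> * real k))"
  have [measurable]: "(\<lambda>z::complex. z ^ k) \<in> borel_measurable borel" by measurable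
  have *: "uniform_measure lborel {0..<2*pi}
      = density lborel (\<lambda>t. ennreal (indicat_real {0..<2*pi} t / (2*pi)))"
    unfolding uniform_measure_def
    by (intro density_cong) (auto simp: indicator_def divide_ennreal simp flip: ennreal_1)
  have "(\<integral>z. z ^ k \<partial>circle) = (\<integral>t. cis t ^ k \<partial>uniform_measure lborel {0..<2*pi})"
    unfolding circle_def by (subst integral_distr) auto
  also have "\<dots> = (\<integral>t. (indicat_real {0..<2*pi} t / (2*pi)) *\<^sub>R cis t ^ k \<partial>lborel)"
    unfolding * by (subst integral_density) auto
  also have "\<dots> = (\<integral>t. (indicat_real {0..2*pi} t *\<^sub>R cis t ^ k) /\<^sub>R (2*pi) \<partial>lborel)"
  proof (rule integral_cong_AE)
    show "AE t in lborel. (indicat_real {0..<2*pi} t / (2*pi)) *\<^sub>R cis t ^ k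
        = (indicat_real {0..2*pi} t *\<^sub>R cis t ^ k) /\<^sub>R (2*pi)"
      using AE_lborel_singleton[of "2*pi"]
    proof eventually_elim
      case (elim t)
      then have "indicat_real {0..<2*pi} t = indicat_real {0..2*pi} t"
        by (auto simp: indicator_def)
      then show ?case by (simp only: scaleR_scaleR divide_inverse mult.commute)
    qed
    show "(\<lambda>t. (indicat_real {0..<2*pi} t / (2*pi)) *\<^sub>R cis t ^ k) \<in> borel_measurable lborel"
      "(\<lambda>t. (indicat_real {0..2*pi} t *\<^sub>R cis t ^ k) /\<^sub>R (2*pi)) \<in> borel_measurable lborel"
      by (intro borel_measurable_scaleR borel_measurable_divide borel_measurable_power; simp)+
  qed
  also have "\<dots> = (\<integral>t. indicat_real {0..2*pi} t *\<^sub>R cis t ^ k \<partial>lborel) /\<^sub>R (2*pi)"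
    by (rule integral_scaleR_right)
  also have "(\<integral>t. indicat_real {0..2*pi} t *\<^sub>R cis t ^ k \<partial>lborel) = F (2*pi) - F 0"
  proof (rule integral_FTC_Icc)
    fix t
    have "((\<lambda>z. exp (\<i> * real k * z) / (\<i> * real k)) has_field_derivative
        exp (\<i> * real k * complex_of_real t)) (at (complex_of_real t))"
      using assms by (auto intro!: derivative_eq_intros)
    then have "(F has_vector_derivative exp (\<i> * real k * complex_of_real t)) (at t within {0..2*pi})"
      unfolding F_def by (rule has_vector_derivative_real_field[THEN has_vector_derivative_at_within])
    moreover have "exp (\<i> * real k * complex_of_real t) = cis t ^ k"
      unfolding cis_conv_exp exp_of_nat_mult[symmetric] by (rule arg_cong[of _ _ exp]) simp
    ultimately show "(F has_vector_derivative cis t ^ k) (at t within {0..2*pi})"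
      by simp
  next
    show "continuous_on {0..2*pi} (\<lambda>t. cis t ^ k)"
      by (intro continuous_intros)
  qed simp
  also have "F (2*pi) = F 0"
  proof -
    have "exp (\<i> * real k * complex_of_real (2*pi)) = cis (2 * pi * real k)"
      unfolding cis_conv_exp by (rule arg_cong[of _ _ exp]) simp
    also have "\<dots> = 1" by (rule cis_multiple_2pi) simp
    finally show ?thesis by (simp add: F_def)
  qed
  finally show ?thesis by simp
qed

lemma fourier_coeff_linear:
  "fourier_coeff 0 n = 0"
  "fourier_coeff (f + g) n = fourier_coeff f n + fourier_coeff g n"
  "fourier_coeff (c *\<^sub>C f) n = c * fourier_coeff f n"
proof -
  show "fourier_coeff (f + g) n = fourier_coeff f n + fourier_coeff g n"
    by (simp add: fourier_coeff_def cinner_add_left)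
  show "fourier_coeff (c *\<^sub>C f) n = c * fourier_coeff f n"
    by (simp add: fourier_coeff_def cinner_scaleC_left)
  show "fourier_coeff 0 n = 0"
    using cinner_add_left[of 0 0 "l2_monom n"] by (simp add: fourier_coeff_def)
qed

lemma l2_poly_pCons: "l2_poly (pCons a p) = a *\<^sub>C l2_monom 0 + l2_mult_z (l2_poly p)"
proof -
  define q where "q = pCons a p"
  have "square_integrable circle (poly q)"
    by (rule square_integrable_circle_bounded[OF borel_measurable_poly AE_circle_poly])
  moreover have "poly q = (\<lambda>z. a * z powi 0 + z * poly p z)"
    by (simp add: q_def fun_eq_iff)
  ultimately have *: "l2_eq (poly q) (\<lambda>z. a * z powi 0 + z * poly p z)"
    by (simp add: l2_eq_def)
  have "l2_poly q = a *\<^sub>C l2_monom 0 + l2_mult_z (l2_poly p)"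
    using * by transfer
  then show ?thesis by (simp add: q_def)
qed

lemma fourier_coeff_one:
  assumes "n < 0" shows "fourier_coeff (l2_monom 0) n = 0"
proof -
  define k where "k = nat (- n)"
  have k: "n = - int k" "k > 0"
    using assms by (simp_all add: k_def)
  have "fourier_coeff (l2_monom 0) n = (\<integral>z. cnj (z powi n) \<partial>circle)"
    unfolding fourier_coeff_def by transfer simp
  also have "\<dots> = (\<integral>z. z ^ k \<partial>circle)"
  proof (rule integral_cong_AE)
    show "AE z in circle. cnj (z powi n) = z ^ k"
      using AE_circle
    proof eventually_elim
      case (elim z)
      then have "z * cnj z = 1" by (simp add: complex_norm_square[symmetric])
      then have "inverse (cnj z) = z" by (intro inverse_unique) (simp add: mult.commute)
      then show ?case
        unfolding k(1) power_int_minus power_int_of_nat complex_cnj_inverse complex_cnj_power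
          power_inverse[symmetric] by simp
    qed
  qed (use borel_measurable_powi in auto)
  finally show ?thesis using integral_circle_power k by simp
qed

lemma fourier_coeff_poly: "n < 0 \<Longrightarrow> fourier_coeff (l2_poly p) n = 0"
proof (induction p arbitrary: n)
  case 0
  have "poly 0 = (\<lambda>_. 0 :: complex)"
    by (simp add: fun_eq_iff)
  then have "l2_eq (poly 0) (\<lambda>_. 0)"
    by (simp add: l2_eq_def square_integrable_def)
  then have "l2_poly 0 = 0"
    using l2_poly.abs_eq zero_l2_circle.abs_eq Quotient_rel_abs[OF Quotient_l2_circle] by metis
  then show ?case by (simp add: fourier_coeff_linear)
next
  case (pCons a p)
  then show ?case
    by (simp add: l2_poly_pCons fourier_coeff_linear fourier_coeff_one fourier_coeff_mult_z)
qed


section \<open>The Hardy space and Hankel operators\<close>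

typedef hardy = "{f :: l2_circle. \<forall>n<0. fourier_coeff f n = 0}"
  morphisms hardy_l2 Abs_hardy
  by (intro exI[of _ 0]) (simp add: fourier_coeff_linear)

setup_lifting type_definition_hardy

instantiation hardy :: complex_inner
begin

lift_definition zero_hardy :: hardy is 0
  by (simp add: fourier_coeff_linear)

lift_definition plus_hardy :: "hardy \<Rightarrow> hardy \<Rightarrow> hardy" is "(+)"
  by (simp add: fourier_coeff_linear)

lift_definition scaleC_hardy :: "complex \<Rightarrow> hardy \<Rightarrow> hardy" is "(*\<^sub>C)"
  by (simp add: fourier_coeff_linear)

lift_definition scaleR_hardy :: "real \<Rightarrow> hardy \<Rightarrow> hardy" is "(*\<^sub>R)"
  by (simp add: fourier_coeff_linear scaleR_scaleC)

lift_definition uminus_hardy :: "hardy \<Rightarrow> hardy" is uminus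
  by (simp add: fourier_coeff_linear uminus_l2_circle_def)

lift_definition minus_hardy :: "hardy \<Rightarrow> hardy \<Rightarrow> hardy" is "(-)"
  by (simp add: fourier_coeff_linear minus_l2_circle_def uminus_l2_circle_def)

lift_definition cinner_hardy :: "hardy \<Rightarrow> hardy \<Rightarrow> complex" is cinner .

lift_definition inner_hardy :: "hardy \<Rightarrow> hardy \<Rightarrow> real" is inner .

lift_definition norm_hardy :: "hardy \<Rightarrow> real" is norm .

definition sgn_hardy :: "hardy \<Rightarrow> hardy" where
  "sgn_hardy f = inverse (norm f) *\<^sub>R f"

definition dist_hardy :: "hardy \<Rightarrow> hardy \<Rightarrow> real" where
  "dist_hardy f g = norm (f - g)"

definition uniformity_hardy :: "(hardy \<times> hardy) filter" where
  "uniformity_hardy = (INF e\<in>{0<..}. principal {(x, y). dist x y < e})"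

definition open_hardy :: "hardy set \<Rightarrow> bool" where
  "open_hardy U \<longleftrightarrow> (\<forall>x\<in>U. \<forall>\<^sub>F (x', y) in uniformity. x' = x \<longrightarrow> y \<in> U)"

instance
proof
  fix x y z :: hardy and c d :: complex and r s :: real
  show "x + y + z = x + (y + z)" "x + y = y + x" "0 + x = x" "- x + x = 0" "x - y = x + - y"
    by (transfer; simp add: algebra_simps)+
  show "r *\<^sub>R (x + y) = r *\<^sub>R x + r *\<^sub>R y" "(r + s) *\<^sub>R x = r *\<^sub>R x + s *\<^sub>R x"
    "r *\<^sub>R s *\<^sub>R x = (r * s) *\<^sub>R x" "1 *\<^sub>R x = x"
    by (transfer; simp add: algebra_simps)+
  show "c *\<^sub>C (x + y) = c *\<^sub>C x + c *\<^sub>C y" "(c + d) *\<^sub>C x = c *\<^sub>C x + d *\<^sub>C x"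
    "c *\<^sub>C d *\<^sub>C x = (c * d) *\<^sub>C x" "1 *\<^sub>C x = x"
    by (transfer; simp add: scaleC_add_left scaleC_add_right scaleC_scaleC scaleC_one)+
  show "r *\<^sub>R x = complex_of_real r *\<^sub>C x"
    by transfer (rule scaleR_scaleC)
  show "cinner x y = cnj (cinner y x)"
    by transfer (rule cinner_commute)
  show "cinner (x + y) z = cinner x z + cinner y z"
    by transfer (rule cinner_add_left)
  show "cinner (c *\<^sub>C x) y = c * cinner x y"
    by transfer (rule cinner_scaleC_left)
  show "inner x y = Re (cinner x y)"
    by transfer (rule inner_eq_Re_cinner)
  show "inner x y = inner y x"
    by transfer (rule inner_commute)
  show "inner (x + y) z = inner x z + inner y z" "inner (r *\<^sub>R x) y = r * inner x y"
    by (transfer; simp add: inner_add_left)+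
  show "0 \<le> inner x x" "inner x x = 0 \<longleftrightarrow> x = 0"
    by (transfer; simp)+
  show "norm x = sqrt (inner x x)"
    by transfer (rule norm_eq_sqrt_inner)
  show "sgn x = inverse (norm x) *\<^sub>R x" by (simp add: sgn_hardy_def)
  show "dist x y = norm (x - y)" by (simp add: dist_hardy_def)
  show "(uniformity :: (hardy \<times> hardy) filter) =
      (INF e\<in>{0<..}. principal {(x, y). dist x y < e})"
    by (simp add: uniformity_hardy_def)
  show "open U \<longleftrightarrow> (\<forall>x\<in>U. \<forall>\<^sub>F (x', y) in uniformity. x' = x \<longrightarrow> y \<in> U)" for U :: "hardy set"
    by (simp add: open_hardy_def)
qed

end

lift_definition hardy_poly :: "complex poly \<Rightarrow> hardy" is l2_poly
  by (simp add: fourier_coeff_poly)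

lift_definition shift :: "hardy \<Rightarrow> hardy" is l2_mult_z
  by (simp add: fourier_coeff_mult_z)

text \<open>The orthogonal projection \<open>P\<close> of \<open>L\<^sup>2\<close> onto the Hardy space.\<close>

definition hardy_proj :: "l2_circle \<Rightarrow> hardy" where
  "hardy_proj f = (THE h. \<forall>g. cinner (f - hardy_l2 h) (hardy_l2 g) = 0)"

text \<open>Bounded mean oscillation over the arcs of the circle.\<close>

definition BMO :: "(complex \<Rightarrow> complex) \<Rightarrow> bool" where
  "BMO f \<longleftrightarrow> integrable circle f \<and>
     (\<exists>C. \<forall>a b. a < b \<and> b \<le> a + 2 * pi \<longrightarrow>
        (let I = cis ` {a..b};
             avg = (LINT z:I|circle. f z) /\<^sub>R measure circle I
         in (LINT z:I|circle. cmod (f z - avg)) / measure circle I \<le> C))"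

definition BMOA :: "hardy set" where
  "BMOA = {u. BMO (l2_fun (hardy_l2 u))}"

text \<open>
  \<open>is_hankel u H\<close> says that \<open>H = H\<^sub>u\<close>: the bounded anti-linear operator given on polynomials
  \<open>p\<close> by \<open>H\<^sub>u p = P(u cnj p)\<close>.  It is unique because the polynomials are dense, and it exists
  exactly for \<open>u\<close> in \<open>BMOA\<close> (Nehari, Fefferman).
\<close>

definition is_hankel :: "hardy \<Rightarrow> (hardy \<Rightarrow> hardy) \<Rightarrow> bool" where
  "is_hankel u H \<longleftrightarrow> bounded_antilinear H \<and>
     (\<forall>p. H (hardy_poly p) = hardy_proj (l2_mult_cnj_poly (hardy_l2 u) p))"

text \<open>
  \<open>hankel_tilde H = S\<^sup>* H\<close>.  The adjoint for the real inner product \<open>Re \<langle>\<cdot>,\<cdot>\<rangle>\<close> of the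
  complex-linear operator \<open>S\<close> is its adjoint for \<open>\<langle>\<cdot>,\<cdot>\<rangle>\<close>.
\<close>

definition hankel_tilde :: "(hardy \<Rightarrow> hardy) \<Rightarrow> hardy \<Rightarrow> hardy" where
  "hankel_tilde H = adjoint shift \<circ> H"

definition BMOA_simp :: "hardy set" where
  "BMOA_simp = {u \<in> BMOA. \<exists>H. is_hankel u H \<and>
     simple_spectrum_on (closure (range H)) (H \<circ> H) \<and>
     simple_spectrum_on (closure (range H)) (hankel_tilde H \<circ> hankel_tilde H)}"

text \<open>
  \<open>spectral_datum u \<rho> \<Psi> \<Psi>t\<close> says that \<open>\<Lambda>(u) = (\<rho>, \<Psi>, \<Psi>t)\<close>, where \<open>\<Psi>\<close> and \<open>\<Psi>t\<close> are
  representatives of classes in \<open>L\<^sup>\<infinity>(\<rho>)\<close> and \<open>L\<^sup>\<infinity>(\<rho>t restricted to (0,\<infinity>))\<close>.  Two such triples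
  of classes agree iff they have a common triple of representatives.

  The vector \<open>u\<close> lies in the closed range \<open>K\<close> of \<open>H\<close>, and \<open>K\<close> reduces \<open>A = |H|\<close> and
  \<open>At = |S\<^sup>* H|\<close>.  Hence \<open>|H| f(|H|)u\<close>, formed on the whole space, is the same vector as the one
  formed with the restrictions of these operators to \<open>K\<close>; likewise for \<open>At\<close>.
\<close>

definition spectral_datum ::
  "hardy \<Rightarrow> real measure \<Rightarrow> (real \<Rightarrow> complex) \<Rightarrow> (real \<Rightarrow> complex) \<Rightarrow> bool" where
  "spectral_datum u \<rho> \<Psi> \<Psi>t \<longleftrightarrow>
     (\<exists>H A At \<rho>t.
        is_hankel u H \<and> is_modulus H A \<and> is_modulus (hankel_tilde H) At \<and>
        is_spectral_measure A u \<rho> \<and> is_spectral_measure At u \<rho>t \<and>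
        \<Psi> \<in> borel_measurable borel \<and> (AE s in \<rho>. cmod (\<Psi> s) = 1) \<and>
        \<Psi>t \<in> borel_measurable borel \<and> (AE s in \<rho>t. 0 < s \<longrightarrow> cmod (\<Psi>t s) = 1) \<and>
        (\<forall>f. square_integrable \<rho> f \<longrightarrow>
           (\<exists>y w. is_L2_calculus A u \<rho> f y \<and>
                  is_L2_calculus A u \<rho> (\<lambda>s. cnj (\<Psi> s) * cnj (f s)) w \<and>
                  H y = A w)) \<and>
        (\<forall>f. square_integrable \<rho>t f \<longrightarrow>
           (\<exists>y w. is_L2_calculus At u \<rho>t f y \<and>
                  is_L2_calculus At u \<rho>t (\<lambda>s. \<Psi>t s * cnj (f s)) w \<and>
                  hankel_tilde H y = At w)))"

end

theory Submission
  imports Defs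
begin

text \<open>
  Let \<open>V\<close> be the closed subspace of pairs generated by \<open>(p(H\<^sub>u\<^sup>2)u, p(H\<^sub>v\<^sup>2)v)\<close>, \<open>p\<close> a polynomial;
  it is the graph of an isometry because the moments of \<open>\<rho>\<close> are shared.  Working with this relation
  instead of an operator avoids any appeal to completeness.  The datum evaluated at \<open>f = 1\<close>
  gives \<open>(H\<^sub>u u, H\<^sub>v v) \<in> V\<close>, and hence \<open>V\<close> is invariant under \<open>H\<close>.  By
  \<open>(S\<^sup>*H)\<^sup>2 = H\<^sup>2 - \<langle>\<cdot>, u\<rangle>u\<close>, the space \<open>V\<close> is also generated from \<open>(u, v)\<close> by the squares of
  \<open>S\<^sup>*H\<close>, so the two measures of \<open>|S\<^sup>*H|\<close> coincide and the second half of the datum makes \<open>V\<close>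
  invariant under \<open>S\<^sup>*H\<close>.  Since \<open>(u, v)\<close> lies in the closure of \<open>H V\<close>, and \<open>\<langle>H x, 1\<rangle> = \<langle>u, x\<rangle>\<close>,
  \<open>V\<close> is invariant under \<open>S\<^sup>*\<close> and \<open>\<langle>\<cdot>, 1\<rangle>\<close> takes equal values on the two entries of a pair.  The Fourier
  coefficients \<open>\<langle>S\<^sup>*\<^sup>n u, 1\<rangle>\<close> and \<open>\<langle>S\<^sup>*\<^sup>n v, 1\<rangle>\<close> therefore agree.
\<close>


section \<open>Complex inner product spaces\<close>

lemma cinner_add_right: "cinner x (y + z) = cinner x y + cinner x z"
  by (metis cinner_add_left cinner_commute complex_cnj_add)

lemma cinner_scaleC_right: "cinner x (c *\<^sub>C y) = cnj c * cinner x y"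
  by (metis cinner_scaleC_left cinner_commute complex_cnj_mult)

lemma scaleC_zero_left [simp]: "0 *\<^sub>C x = (0::'a::complex_inner)"
  using scaleC_add_left[of 0 0 x] by simp

lemma scaleC_zero_right [simp]: "c *\<^sub>C (0::'a::complex_inner) = 0"
  using scaleC_add_right[of c 0 "0::'a"] by simp

lemma scaleC_minus_one [simp]: "(- 1) *\<^sub>C x = - (x::'a::complex_inner)"
  using scaleR_scaleC[of "- 1" x] by simp

lemma cinner_zero_left [simp]: "cinner 0 x = 0"
  using cinner_add_left[of 0 0 x] by simp

lemma cinner_zero_right [simp]: "cinner x 0 = 0"
  using cinner_add_right[of x 0 0] by simp

lemma cinner_diff_left: "cinner (x - y) z = cinner x z - cinner y z"
  using cinner_add_left[of "x - y" y z] by simp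

lemma cinner_diff_right: "cinner z (x - y) = cinner z x - cinner z y"
  using cinner_add_right[of z "x - y" y] by simp

text \<open>The imaginary part is again a real inner product, so limits and continuity of
  \<open>cinner\<close> follow from those of \<open>inner\<close>.\<close>

lemma cinner_eq_inner: "cinner x y = Complex (inner x y) (inner x (\<i> *\<^sub>C y))"
  by (simp add: complex_eq_iff inner_eq_Re_cinner cinner_scaleC_right)

lemma cinner_self: "cinner x x = complex_of_real ((norm x)\<^sup>2)"
proof -
  have "Im (cinner x x) = 0"
    using arg_cong[OF cinner_commute[of x x], of Im] by simp
  then show ?thesis
    by (simp add: complex_eq_iff power2_norm_eq_inner inner_eq_Re_cinner)
qed

lemma norm_scaleC: "norm (c *\<^sub>C x) = cmod c * norm (x::'a::complex_inner)"
proof -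
  have "complex_of_real ((norm (c *\<^sub>C x))\<^sup>2) = complex_of_real ((cmod c * norm x)\<^sup>2)"
    unfolding cinner_self[symmetric] cinner_scaleC_left cinner_scaleC_right
    by (simp add: cinner_self power_mult_distrib complex_norm_square mult.assoc[symmetric]
        del: of_real_power)
  then have "(norm (c *\<^sub>C x))\<^sup>2 = (cmod c * norm x)\<^sup>2"
    using of_real_eq_iff by blast
  then show ?thesis by (simp add: power2_eq_iff_nonneg)
qed

lemma bounded_linear_scaleC: "bounded_linear (\<lambda>x::'a::complex_inner. c *\<^sub>C x)"
proof (rule bounded_linear_intro)
  show "norm (c *\<^sub>C x) \<le> norm x * cmod c" for x :: 'a
    by (simp add: norm_scaleC)
qed (simp_all add: scaleC_add_right scaleR_scaleC scaleC_scaleC mult.commute)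

lemmas tendsto_scaleC [tendsto_intros] = bounded_linear.tendsto[OF bounded_linear_scaleC]

lemma tendsto_cinner [tendsto_intros]:
  fixes f g :: "'b \<Rightarrow> 'a::complex_inner"
  assumes "(f \<longlongrightarrow> a) F" "(g \<longlongrightarrow> b) F"
  shows "((\<lambda>x. cinner (f x) (g x)) \<longlongrightarrow> cinner a b) F"
  unfolding cinner_eq_inner by (intro tendsto_Complex tendsto_intros assms)

lemma continuous_on_cinner [continuous_intros]:
  fixes f g :: "'b::topological_space \<Rightarrow> 'a::complex_inner"
  assumes "continuous_on S f" "continuous_on S g"
  shows "continuous_on S (\<lambda>x. cinner (f x) (g x))"
  using assms unfolding continuous_on_def by (auto intro: tendsto_cinner)

lemma cinner_ext:
  assumes "\<And>z. cinner x z = cinner y z" shows "x = y"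
proof -
  have "cinner (x - y) (x - y) = 0" by (simp only: cinner_diff_left assms diff_self)
  then show ?thesis by (simp add: cinner_self)
qed

lemma bounded_clinearD:
  assumes "bounded_clinear A"
  shows "bounded_linear A" "A (c *\<^sub>C x) = c *\<^sub>C A x"
    "A (x + y) = A x + A y" "A (x - y) = A x - A y" "A 0 = 0"
  using assms by (auto simp: bounded_clinear_def linear_simps)

lemma bounded_antilinearD:
  assumes "bounded_antilinear A"
  shows "bounded_linear A" "A (c *\<^sub>C x) = cnj c *\<^sub>C A x"
    "A (x + y) = A x + A y" "A (x - y) = A x - A y" "A 0 = 0"
  using assms by (auto simp: bounded_antilinear_def linear_simps)

lemma bounded_clinear_compose:
  assumes "bounded_clinear A" "bounded_clinear B" shows "bounded_clinear (A \<circ> B)"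
  using assms bounded_linear_compose[of A B] unfolding bounded_clinear_def o_def by simp

text \<open>Polarization: the quadratic form is real at \<open>x + y\<close> and at
  \<open>x + \<i> *\<^sub>C y\<close>, and the cross terms of these two values give the imaginary
  and the real part of the identity.\<close>

lemma psd_symmetric:
  assumes "psd A" shows "cinner (A x) y = cinner x (A y)"
proof -
  have lin: "bounded_clinear A" and real: "Im (cinner (A z) z) = 0" for z
    using assms by (auto simp: psd_def complex_nonneg_Reals_iff)
  note [simp] = bounded_clinearD[OF lin] cinner_add_left cinner_add_right cinner_scaleC_left
    cinner_scaleC_right
  have "Im (cinner (A x) y) + Im (cinner (A y) x) = 0"
    using real[of "x + y"] real[of x] real[of y] by simp
  moreover have "Re (cinner (A y) x) - Re (cinner (A x) y) = 0"
    using real[of "x + \<i> *\<^sub>C y"] real[of x] real[of y] by simp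
  ultimately have "cinner (A x) y = cnj (cinner (A y) x)"
    by (simp add: complex_eq_iff)
  then show ?thesis by (simp add: cinner_commute[of x])
qed


section \<open>Polynomials of operators\<close>

lemma poly_op_eq_sum:
  fixes A :: "'a::complex_inner \<Rightarrow> 'a"
  assumes "degree p \<le> n" shows "poly_op A p x = (\<Sum>i\<le>n. coeff p i *\<^sub>C (A ^^ i) x)"
  unfolding poly_op_def
  by (rule sum.mono_neutral_left) (use assms in \<open>auto simp: coeff_eq_0\<close>)

lemma poly_op_0 [simp]: "poly_op A 0 x = 0"
  by (simp add: poly_op_def)

lemma poly_op_add: "poly_op A (p + q) x = poly_op A p x + poly_op A q x"
proof -
  define n where "n = max (degree p) (degree q)"
  have "degree (p + q) \<le> n" "degree p \<le> n" "degree q \<le> n"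
    unfolding n_def by (auto intro: degree_add_le_max)
  note this[THEN poly_op_eq_sum, of A x]
  then show ?thesis
    by (simp only: coeff_add scaleC_add_left sum.distrib)
qed

lemma poly_op_smult: "poly_op A (smult c p) x = c *\<^sub>C poly_op A p x"
proof -
  have "c *\<^sub>C sum f S = (\<Sum>i\<in>S. c *\<^sub>C f i)" for f :: "nat \<Rightarrow> 'a" and S
    by (rule Real_Vector_Spaces.linear_sum[OF bounded_linear.linear[OF bounded_linear_scaleC]])
  then show ?thesis
    by (simp add: poly_op_eq_sum[OF degree_smult_le] poly_op_def scaleC_scaleC)
qed

lemma poly_op_diff: "poly_op A (p - q) x = poly_op A p x - poly_op A q x"
  using poly_op_add[of A "p - q" q x] by simp

lemma poly_op_pCons:
  assumes "bounded_clinear A"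
  shows "poly_op A (pCons a p) x = a *\<^sub>C x + A (poly_op A p x)"
proof -
  have "poly_op A (pCons a p) x = (\<Sum>i\<le>Suc (degree p). coeff (pCons a p) i *\<^sub>C (A ^^ i) x)"
    by (intro poly_op_eq_sum degree_pCons_le)
  also have "\<dots> = a *\<^sub>C x + (\<Sum>i\<le>degree p. coeff p i *\<^sub>C A ((A ^^ i) x))"
    by (simp add: sum.atMost_Suc_shift del: sum.atMost_Suc)
  also have "(\<Sum>i\<le>degree p. coeff p i *\<^sub>C A ((A ^^ i) x)) = A (poly_op A p x)"
    unfolding poly_op_def
    by (simp add: Real_Vector_Spaces.linear_sum[OF bounded_linear.linear] bounded_clinearD[OF assms])
  finally show ?thesis .
qed

lemma bounded_clinear_poly_op:
  assumes "bounded_clinear A" shows "bounded_clinear (poly_op A p)"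
proof (induction p)
  case 0
  have "poly_op A 0 = (\<lambda>_. 0)" by (simp add: fun_eq_iff)
  then show ?case by (simp add: bounded_clinear_def)
next
  case (pCons a p)
  have eq: "poly_op A (pCons a p) = (\<lambda>x. a *\<^sub>C x + A (poly_op A p x))"
    by (simp add: fun_eq_iff poly_op_pCons[OF assms])
  have "bounded_linear (\<lambda>x. a *\<^sub>C x + A (poly_op A p x))"
    using bounded_linear_add[OF bounded_linear_scaleC[of a]
        bounded_linear_compose[OF bounded_clinearD(1)[OF assms] bounded_clinearD(1)[OF pCons.IH]]] .
  then show ?case
    using pCons unfolding bounded_clinear_def eq
    by (simp add: bounded_clinearD[OF assms] scaleC_add_right scaleC_scaleC mult.commute)
qed

lemma poly_op_mult:
  assumes "bounded_clinear A"
  shows "poly_op A (p * q) x = poly_op A p (poly_op A q x)"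
proof (induction p)
  case (pCons a p)
  have "poly_op A (pCons a p * q) x = poly_op A (smult a q) x + poly_op A (pCons 0 (p * q)) x"
    by (simp only: mult_pCons_left poly_op_add)
  then show ?case
    by (simp add: poly_op_pCons[OF assms] poly_op_smult pCons)
qed simp

text \<open>Even polynomials in \<open>A\<close> see only \<open>A \<circ> A\<close>. When
  \<open>A\<close> is the modulus of \<open>H\<close>, this is \<open>H \<circ> H\<close>, so
  calculus of the modulus can be reduced to powers of the Hankel operator itself.\<close>

lemma poly_op_square:
  assumes "bounded_clinear A"
  shows "poly_op A (p \<circ>\<^sub>p [:0, 0, 1:]) x = poly_op (A \<circ> A) p x"
proof (induction p)
  case (pCons a p)
  have "poly_op A (pCons a p \<circ>\<^sub>p [:0, 0, 1:]) x
      = poly_op A [:a:] x + poly_op A ([:0, 0, 1:] * (p \<circ>\<^sub>p [:0, 0, 1:])) x"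
    by (simp only: pcompose_pCons poly_op_add)
  also have "\<dots> = a *\<^sub>C x + A (A (poly_op (A \<circ> A) p x))"
    unfolding poly_op_mult[OF assms] pCons.IH
    by (simp add: poly_op_pCons[OF assms] bounded_clinearD[OF assms] scaleC_one)
  finally show ?case
    unfolding poly_op_pCons[OF bounded_clinear_compose[OF assms assms]] o_apply[of A A "poly_op (A \<circ> A) p x"] .
qed simp

lemma cinner_poly_op:
  assumes "psd A"
  shows "cinner (poly_op A p x) y = cinner x (poly_op A (map_poly cnj p) y)"
proof (induction p arbitrary: x y)
  case (pCons a p)
  have A: "bounded_clinear A" using assms by (simp add: psd_def)
  have comm: "A (poly_op A q z) = poly_op A q (A z)" for q z
    by (induction q) (simp_all add: poly_op_pCons[OF A] bounded_clinearD[OF A])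
  have "map_poly cnj (pCons a p) = pCons (cnj a) (map_poly cnj p)"
    by (rule map_poly_pCons) simp
  then show ?case
    by (simp add: poly_op_pCons[OF A] cinner_add_left cinner_add_right cinner_scaleC_left
        cinner_scaleC_right psd_symmetric[OF assms] pCons comm)
qed (simp add: map_poly_0)

text \<open>The adjoint of \<open>p(A)\<close> has the conjugated coefficients, so the squared norm
  becomes a quadratic form of a polynomial in \<open>A\<close>, which a spectral measure
  evaluates.\<close>

lemma norm_poly_op_square:
  assumes "psd A"
  shows "complex_of_real ((norm (poly_op A p x))\<^sup>2) = cinner (poly_op A (map_poly cnj p * p) x) x"
proof -
  have A: "bounded_clinear A" using assms by (simp add: psd_def)
  have cc: "map_poly cnj (map_poly cnj p) = p"
    by (simp add: poly_eq_iff coeff_map_poly)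
  show ?thesis
    unfolding cinner_self[symmetric] poly_op_mult[OF A] cinner_poly_op[OF assms, of "map_poly cnj p"] cc ..
qed


section \<open>Pairs of vectors\<close>

definition pair_subspace :: "('a::complex_inner \<times> 'b::complex_inner) set \<Rightarrow> bool" where
  "pair_subspace W \<longleftrightarrow> closed W \<and> (0, 0) \<in> W \<and>
     (\<forall>x y x' y'. (x, y) \<in> W \<longrightarrow> (x', y') \<in> W \<longrightarrow> (x + x', y + y') \<in> W) \<and>
     (\<forall>c x y. (x, y) \<in> W \<longrightarrow> (c *\<^sub>C x, c *\<^sub>C y) \<in> W)"

definition maps_pairs :: "('a \<times> 'b) set \<Rightarrow> ('a \<Rightarrow> 'a) \<Rightarrow> ('b \<Rightarrow> 'b) \<Rightarrow> bool" where
  "maps_pairs W F G \<longleftrightarrow> (\<forall>x y. (x, y) \<in> W \<longrightarrow> (F x, G y) \<in> W)"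

text \<open>Taken as an intersection instead of the closure of a span: a further property of all
  pairs is then proved by showing that the pairs which have it form an invariant closed subspace
  containing \<open>(u, v)\<close>.\<close>

definition cyclic_pairs :: "('a::complex_inner \<Rightarrow> 'a) \<Rightarrow> ('b::complex_inner \<Rightarrow> 'b) \<Rightarrow> 'a \<Rightarrow> 'b \<Rightarrow> ('a \<times> 'b) set" where
  "cyclic_pairs F G u v = \<Inter>{W. pair_subspace W \<and> (u, v) \<in> W \<and> maps_pairs W F G}"

lemma pair_subspaceD:
  assumes "pair_subspace W"
  shows "closed W" "(0, 0) \<in> W" "(x, y) \<in> W \<Longrightarrow> (x', y') \<in> W \<Longrightarrow> (x + x', y + y') \<in> W"
    "(x, y) \<in> W \<Longrightarrow> (c *\<^sub>C x, c *\<^sub>C y) \<in> W"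
  using assms by (auto simp: pair_subspace_def)

lemma pair_subspace_diff:
  assumes "pair_subspace W" "(x, y) \<in> W" "(x', y') \<in> W" shows "(x - x', y - y') \<in> W"
proof -
  have "((- 1) *\<^sub>C x', (- 1) *\<^sub>C y') \<in> W"
    using assms(1,3) by (rule pair_subspaceD)
  with assms(1,2) have "(x + (- 1) *\<^sub>C x', y + (- 1) *\<^sub>C y') \<in> W"
    by (rule pair_subspaceD)
  then show ?thesis by simp
qed

lemma maps_pairsD: "maps_pairs W F G \<Longrightarrow> (x, y) \<in> W \<Longrightarrow> (F x, G y) \<in> W"
  by (simp add: maps_pairs_def)

lemma pair_subspace_limit:
  assumes "pair_subspace W" "x \<longlonglongrightarrow> a" "y \<longlonglongrightarrow> b" "\<And>n. (x n, y n) \<in> W"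
  shows "(a, b) \<in> W"
  using closed_sequentially[OF pair_subspaceD(1)[OF assms(1)], of "\<lambda>n. (x n, y n)"]
    assms(4) tendsto_Pair[OF assms(2,3)] by blast

lemma pair_subspace_Int: "pair_subspace V \<Longrightarrow> pair_subspace W \<Longrightarrow> pair_subspace (V \<inter> W)"
  by (auto simp: pair_subspace_def)

lemma pair_subspace_Inter: "(\<And>W. W \<in> \<W> \<Longrightarrow> pair_subspace W) \<Longrightarrow> pair_subspace (\<Inter>\<W>)"
  unfolding pair_subspace_def by (intro conjI closed_Inter) blast+

lemma pair_subspace_cinner_eq: "pair_subspace {(x, y). cinner x a = cinner y b}"
proof -
  have "closed {p. cinner (fst p) a = cinner (snd p) b}"
    by (intro closed_Collect_eq continuous_intros)
  then show ?thesis
    by (auto simp: pair_subspace_def case_prod_unfold cinner_add_left cinner_scaleC_left)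
qed

lemma pair_subspace_cinner_eq':  "pair_subspace {(x, y). cinner a x = cinner b y}"
proof -
  have "closed {p. cinner a (fst p) = cinner b (snd p)}"
    by (intro closed_Collect_eq continuous_intros)
  then show ?thesis
    by (auto simp: pair_subspace_def case_prod_unfold cinner_add_right cinner_scaleC_right)
qed

lemma closed_pair_vimage:
  assumes "bounded_linear F" "bounded_linear G" "closed W"
  shows "closed {(x, y). (F x, G y) \<in> W}"
proof -
  have "continuous_on UNIV (\<lambda>p. (F (fst p), G (snd p)))"
    by (intro continuous_intros bounded_linear.continuous_on[OF assms(1)]
        bounded_linear.continuous_on[OF assms(2)])
  then have "closed ((\<lambda>p. (F (fst p), G (snd p))) -` W)"
    using assms(3) by (simp add: continuous_on_closed_vimage)
  then show ?thesis by (simp add: vimage_def case_prod_unfold)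
qed

lemma pair_subspace_vimage:
  assumes "bounded_clinear F" "bounded_clinear G" "pair_subspace W"
  shows "pair_subspace {(x, y). (F x, G y) \<in> W}"
  using closed_pair_vimage[OF bounded_clinearD(1)[OF assms(1)] bounded_clinearD(1)[OF assms(2)]] assms(3)
  by (auto simp: pair_subspace_def bounded_clinearD[OF assms(1)] bounded_clinearD[OF assms(2)])

lemma pair_subspace_vimage_antilinear:
  assumes "bounded_antilinear F" "bounded_antilinear G" "pair_subspace W"
  shows "pair_subspace {(x, y). (F x, G y) \<in> W}"
  using closed_pair_vimage[OF bounded_antilinearD(1)[OF assms(1)] bounded_antilinearD(1)[OF assms(2)]] assms(3)
  by (auto simp: pair_subspace_def bounded_antilinearD[OF assms(1)] bounded_antilinearD[OF assms(2)])

lemma cyclic_pairs_subspace: "pair_subspace (cyclic_pairs F G u v)"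
  unfolding cyclic_pairs_def by (rule pair_subspace_Inter) blast

lemma cyclic_pairs_base: "(u, v) \<in> cyclic_pairs F G u v"
  by (simp add: cyclic_pairs_def)

lemma cyclic_pairs_maps: "maps_pairs (cyclic_pairs F G u v) F G"
  by (auto simp: cyclic_pairs_def maps_pairs_def)

lemma cyclic_pairs_least:
  "pair_subspace W \<Longrightarrow> (u, v) \<in> W \<Longrightarrow> maps_pairs W F G \<Longrightarrow> cyclic_pairs F G u v \<subseteq> W"
  by (auto simp: cyclic_pairs_def)

text \<open>Minimality is used once for each argument of the inner product. Symmetry of
  \<open>F\<close> and \<open>G\<close> moves the operators to the other argument, where the
  equality is already known.\<close>

lemma cyclic_pairs_isometric:
  assumes "\<And>x y. cinner (F x) y = cinner x (F y)" "\<And>x y. cinner (G x) y = cinner x (G y)"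
    and moments: "\<And>k. cinner ((F ^^ k) u) u = cinner ((G ^^ k) v) v"
    and "(x, y) \<in> cyclic_pairs F G u v" "(x', y') \<in> cyclic_pairs F G u v"
  shows "cinner x x' = cinner y y'"
proof -
  let ?V = "cyclic_pairs F G u v"
  have sym: "cinner ((F ^^ k) u) x = cinner u ((F ^^ k) x)" "cinner ((G ^^ k) v) y = cinner v ((G ^^ k) y)"
    for k x y by (induction k arbitrary: x y) (simp_all add: assms(1,2) flip: funpow_swap1)
  \<comment> \<open>All iterates are tested at once, because moving \<open>F\<close> across the
    inner product raises the exponent by one.\<close>
  define W where "W = (\<Inter>k. {(x, y). cinner x ((F ^^ k) u) = cinner y ((G ^^ k) v)})"
  have "?V \<subseteq> W"
  proof (rule cyclic_pairs_least)
    show "pair_subspace W"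
      unfolding W_def by (rule pair_subspace_Inter) (auto simp: pair_subspace_cinner_eq)
    show "(u, v) \<in> W"
      using moments by (auto simp: W_def cinner_commute[of u] cinner_commute[of v])
    show "maps_pairs W F G"
      unfolding maps_pairs_def
    proof (intro allI impI)
      fix x y assume "(x, y) \<in> W"
      then have "cinner x ((F ^^ Suc k) u) = cinner y ((G ^^ Suc k) v)" for k
        unfolding W_def by blast
      then show "(F x, G y) \<in> W" by (simp add: W_def assms)
    qed
  qed
  then have *: "cinner a u = cinner b v" if "(a, b) \<in> ?V" for a b
    using that unfolding W_def by (auto dest!: subsetD spec[of _ "0::nat"])
  \<comment> \<open>Now the other argument runs over all pairs of the relation; the fact
    \<open>*\<close> is the case of the generator.\<close>
  define W' where "W' = \<Inter>((\<lambda>(a, b). {(x, y). cinner a x = cinner b y}) ` ?V)"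
  have W': "(x, y) \<in> W' \<longleftrightarrow> (\<forall>a b. (a, b) \<in> ?V \<longrightarrow> cinner a x = cinner b y)" for x y
    unfolding W'_def by auto
  have "?V \<subseteq> W'"
  proof (rule cyclic_pairs_least)
    show "pair_subspace W'"
      unfolding W'_def by (rule pair_subspace_Inter) (auto simp: pair_subspace_cinner_eq')
    show "(u, v) \<in> W'"
      using * W' by blast
    show "maps_pairs W' F G"
      unfolding maps_pairs_def
    proof (intro allI impI)
      fix x y assume xy: "(x, y) \<in> W'"
      have "cinner (F a) x = cinner (G b) y" if "(a, b) \<in> ?V" for a b
        using maps_pairsD[OF cyclic_pairs_maps that] xy W' by blast
      then show "(F x, G y) \<in> W'" by (simp only: W' assms) blast
    qed
  qed
  with assms(4,5) W' show ?thesis by blast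
qed

lemma maps_pairs_poly_op:
  assumes "pair_subspace W" "maps_pairs W F G" "bounded_clinear F" "bounded_clinear G"
  shows "maps_pairs W (poly_op F p) (poly_op G p)"
proof (induction p)
  case 0
  then show ?case using pair_subspaceD(2)[OF assms(1)] by (simp add: maps_pairs_def)
next
  case (pCons a p)
  then show ?case
    by (auto simp: maps_pairs_def poly_op_pCons assms
        intro!: pair_subspaceD[OF assms(1)] maps_pairsD[OF assms(2)])
qed


section \<open>Functional calculus and spectral measures\<close>

lemma real_polynomial_function_imp_poly:
  fixes g :: "real \<Rightarrow> real"
  assumes "real_polynomial_function g"
  obtains p :: "complex poly" where "\<And>s. poly p (of_real s) = of_real (g s)"
proof -
  obtain a n where g: "g = (\<lambda>x. \<Sum>i\<le>n. a i * x ^ i)"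
    using assms real_polynomial_function_imp_sum by blast
  have "poly (\<Sum>i\<le>n. monom (complex_of_real (a i)) i) (of_real s) = of_real (g s)" for s
    by (simp add: g poly_sum poly_monom)
  then show ?thesis by (rule that)
qed

lemma polynomial_function_imp_poly:
  fixes g :: "real \<Rightarrow> complex"
  assumes "polynomial_function g"
  obtains p where "\<And>s. poly p (of_real s) = g s"
proof -
  have "real_polynomial_function (Re \<circ> g)" "real_polynomial_function (Im \<circ> g)"
    using assms bounded_linear_Re bounded_linear_Im unfolding polynomial_function_def by blast+
  then obtain p q :: "complex poly" where pq: "\<And>s. poly p (of_real s) = of_real ((Re \<circ> g) s)"
    "\<And>s. poly q (of_real s) = of_real ((Im \<circ> g) s)"
    by (elim real_polynomial_function_imp_poly) blast
  have "poly (p + smult \<i> q) (of_real s) = g s" for s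
    using pq by (simp add: complex_eq_iff)
  then show ?thesis by (rule that)
qed

text \<open>Weierstrass is applied to \<open>t \<mapsto> f (sqrt t)\<close> and
  \<open>t = s^2\<close> is substituted afterwards. On a half-line no parity obstructs this, so even
  polynomials, and with them polynomials in \<open>A \<circ> A\<close>, reach every continuous
  function of \<open>A\<close>.\<close>

lemma even_polynomial_approximation:
  fixes f :: "real \<Rightarrow> complex"
  assumes "continuous_on UNIV f"
  obtains q :: "nat \<Rightarrow> complex poly"
  where "uniform_limit {0..N} (\<lambda>n s. poly (q n \<circ>\<^sub>p [:0, 0, 1:]) (of_real s)) f sequentially"
proof -
  have "continuous_on {0..N\<^sup>2} (\<lambda>t. f (sqrt t))"
    by (rule continuous_on_compose2[OF assms]) (auto intro!: continuous_intros)
  then obtain g where g: "uniform_limit {0..N\<^sup>2} g (\<lambda>t. f (sqrt t)) sequentially"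
    "\<And>n. polynomial_function (g n)"
    using Stone_Weierstrass_uniform_limit[OF compact_Icc] by blast
  have "\<exists>p. \<forall>s. poly p (of_real s) = g n s" for n
    using polynomial_function_imp_poly[OF g(2)] by metis
  then obtain q where q: "\<And>n s. poly (q n) (of_real s) = g n s"
    by metis
  have "uniform_limit {0..N} (\<lambda>n s. g n (s\<^sup>2)) (\<lambda>s. f (sqrt (s\<^sup>2))) sequentially"
    using g(1) by (rule uniform_limit_compose') (auto intro: power_mono)
  also have "?this \<longleftrightarrow> uniform_limit {0..N} (\<lambda>n s. poly (q n \<circ>\<^sub>p [:0, 0, 1:]) (of_real s)) f sequentially"
    by (rule uniform_limit_cong') (simp_all add: poly_pcompose q[symmetric] power2_eq_square)
  finally show ?thesis by (rule that)
qed

section \<open>Continuous calculus and invariant relations\<close>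

lemma cont_calculus_tendsto:
  assumes "bounded_clinear A" "is_cont_calculus A f B"
    and "uniform_limit {0..onorm A} (\<lambda>n s. poly (p n) (of_real s)) f sequentially"
  shows "(\<lambda>n. poly_op A (p n) x) \<longlonglongrightarrow> B x"
proof -
  have B: "bounded_linear B" and lim: "(\<lambda>n. onorm (\<lambda>x. poly_op A (p n) x - B x)) \<longlonglongrightarrow> 0"
    using assms(2,3) by (auto simp: is_cont_calculus_def bounded_clinear_def)
  have "norm (poly_op A (p n) x - B x) \<le> onorm (\<lambda>x. poly_op A (p n) x - B x) * norm x" for n
    by (rule onorm[OF bounded_linear_sub[OF bounded_clinearD(1)[OF bounded_clinear_poly_op[OF assms(1)]] B]])
  then have "(\<lambda>n. poly_op A (p n) x - B x) \<longlonglongrightarrow> 0"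
    by (intro Lim_null_comparison[OF _ tendsto_mult_left_zero[OF lim, of "norm x"]]) simp
  then show ?thesis by (simp add: LIM_zero_iff)
qed

lemma cont_calculus_poly:
  assumes "bounded_clinear A" "is_cont_calculus A (\<lambda>s. poly p (of_real s)) B"
  shows "B x = poly_op A p x"
  using cont_calculus_tendsto[OF assms, of "\<lambda>_. p" x]
  by (intro LIMSEQ_unique[OF _ tendsto_const]) (simp add: uniform_limit_iff)

text \<open>Invariance under the squares is enough, since the approximating polynomials can be
  chosen even.\<close>

lemma maps_pairs_cont_calculus:
  assumes W: "pair_subspace W" and "maps_pairs W (A \<circ> A) (A' \<circ> A')"
    and A: "bounded_clinear A" and A': "bounded_clinear A'"
    and B: "is_cont_calculus A f B" and B': "is_cont_calculus A' f B'" and "continuous_on UNIV f"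
  shows "maps_pairs W B B'"
  unfolding maps_pairs_def
proof (intro allI impI)
  fix x y assume xy: "(x, y) \<in> W"
  \<comment> \<open>The interval covers the spectra of both operators, so that one sequence of
    polynomials serves both entries of a pair.\<close>
  obtain q where q: "uniform_limit {0..max (onorm A) (onorm A')}
      (\<lambda>n s. poly (q n \<circ>\<^sub>p [:0, 0, 1:]) (of_real s)) f sequentially"
    using even_polynomial_approximation[OF assms(7)] by blast
  have "(\<lambda>n. poly_op A (q n \<circ>\<^sub>p [:0, 0, 1:]) x) \<longlonglongrightarrow> B x"
    by (rule cont_calculus_tendsto[OF A B uniform_limit_on_subset[OF q]]) auto
  moreover have "(\<lambda>n. poly_op A' (q n \<circ>\<^sub>p [:0, 0, 1:]) y) \<longlonglongrightarrow> B' y"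
    by (rule cont_calculus_tendsto[OF A' B' uniform_limit_on_subset[OF q]]) auto
  moreover have "(poly_op A (q n \<circ>\<^sub>p [:0, 0, 1:]) x, poly_op A' (q n \<circ>\<^sub>p [:0, 0, 1:]) y) \<in> W" for n
    unfolding poly_op_square[OF A] poly_op_square[OF A']
    by (rule maps_pairsD[OF maps_pairs_poly_op[OF W assms(2)] xy])
      (intro bounded_clinear_compose A A')+
  ultimately show "(B x, B' y) \<in> W"
    by (rule pair_subspace_limit[OF W])
qed

section \<open>Integrals against a spectral measure\<close>

lemma spectral_measure_calculus:
  assumes "is_spectral_measure A u \<mu>" "continuous_on UNIV f"
  obtains B where "is_cont_calculus A f B" "has_bochner_integral \<mu> f (cinner (B u) u)"
  using assms by (auto simp: is_spectral_measure_def)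

lemma continuous_on_poly_of_real: "continuous_on UNIV (\<lambda>s::real. poly p (complex_of_real s))"
  by (intro continuous_intros)

lemma spectral_measure_poly:
  assumes "bounded_clinear A" "is_spectral_measure A u \<mu>"
  shows "cinner (poly_op A p u) u = (\<integral>s. poly p (of_real s) \<partial>\<mu>)"
proof (rule spectral_measure_calculus[OF assms(2) continuous_on_poly_of_real[of p]])
  fix B assume "is_cont_calculus A (\<lambda>s. poly p (of_real s)) B"
    and B: "has_bochner_integral \<mu> (\<lambda>s. poly p (of_real s)) (cinner (B u) u)"
  then show ?thesis
    using cont_calculus_poly[OF assms(1)] has_bochner_integral_integral_eq[OF B] by simp
qed

text \<open>A spectral measure supplies some operator for each continuous function; for a polynomial
  function that operator can only be the polynomial of \<open>A\<close>.\<close>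

lemma spectral_measure_identity:
  assumes "bounded_clinear A" "is_spectral_measure A u \<mu>"
  shows "is_cont_calculus A (\<lambda>_. 1) (\<lambda>x. x)" "is_cont_calculus A of_real A"
proof -
  have "continuous_on UNIV (\<lambda>s::real. 1 :: complex)" "continuous_on UNIV complex_of_real"
    by (intro continuous_intros)+
  then obtain B C where BC: "is_cont_calculus A (\<lambda>_. 1) B" "is_cont_calculus A of_real C"
    by (elim spectral_measure_calculus[OF assms(2)]) blast
  have "B x = poly_op A 1 x" for x
    by (rule cont_calculus_poly[OF assms(1)]) (simp add: BC)
  moreover have "C x = poly_op A [:0, 1:] x" for x
    by (rule cont_calculus_poly[OF assms(1)]) (simp add: BC)
  ultimately have "B = (\<lambda>x. x)" "C = A"
    by (simp_all add: fun_eq_iff one_pCons poly_op_pCons[OF assms(1)] bounded_clinearD[OF assms(1)] scaleC_one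
        del: pCons_one)
  with BC show "is_cont_calculus A (\<lambda>_. 1) (\<lambda>x. x)" "is_cont_calculus A of_real A" by simp_all
qed

text \<open>This is the isometry \<open>g \<mapsto> g(A)u\<close> from continuous functions with the
  norm of \<open>L^2(\<mu>)\<close>, stated with the nonnegative integral that occurs in
  \<open>is_L2_calculus\<close>.\<close>

lemma spectral_measure_norm_diff:
  assumes "psd A" "is_spectral_measure A u \<mu>"
    and f: "is_cont_calculus A f F" "continuous_on UNIV f"
    and g: "is_cont_calculus A g G" "continuous_on UNIV g"
  shows "(\<integral>\<^sup>+ s. ennreal ((cmod (f s - g s))\<^sup>2) \<partial>\<mu>) = ennreal ((norm (F u - G u))\<^sup>2)"
proof -
  have A: "bounded_clinear A" using assms(1) by (simp add: psd_def)
  define h where "h = (\<lambda>s. f s - g s)"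
  have h: "continuous_on UNIV h"
    unfolding h_def by (intro continuous_intros f g)
  then have "continuous_on UNIV (\<lambda>s. cnj (h s) * h s)"
    by (intro continuous_intros)
  \<comment> \<open>The quadratic form of this operator at \<open>u\<close> is the integral of
    \<open>|f - g|^2\<close>, and it is also the limit of the squared norms of
    \<open>poly_op A (r n) u\<close>.\<close>
  then obtain C where C: "is_cont_calculus A (\<lambda>s. cnj (h s) * h s) C"
    "has_bochner_integral \<mu> (\<lambda>s. cnj (h s) * h s) (cinner (C u) u)"
    using spectral_measure_calculus[OF assms(2)] by blast
  let ?I = "{0..onorm A}"
  obtain q where
    q: "uniform_limit ?I (\<lambda>n s. poly (q n \<circ>\<^sub>p [:0, 0, 1:]) (of_real s)) f sequentially"
    using even_polynomial_approximation[OF f(2)] by blast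
  obtain q' where
    q': "uniform_limit ?I (\<lambda>n s. poly (q' n \<circ>\<^sub>p [:0, 0, 1:]) (of_real s)) g sequentially"
    using even_polynomial_approximation[OF g(2)] by blast
  define r where "r n = q n \<circ>\<^sub>p [:0, 0, 1:] - q' n \<circ>\<^sub>p [:0, 0, 1:]" for n
  have r: "uniform_limit ?I (\<lambda>n s. poly (r n) (of_real s)) h sequentially"
    unfolding r_def h_def poly_diff by (intro uniform_limit_intros q q')
  have bdd: "bounded (h ` ?I)" "bounded ((\<lambda>s. cnj (h s)) ` ?I)"
    using h by (intro compact_imp_bounded compact_continuous_image continuous_intros;
        force intro: continuous_on_subset)+
  have cnj_poly: "poly (map_poly cnj p) (of_real s) = cnj (poly p (of_real s))" for p and s :: real
    using poly_cnj[of p "of_real s"] by simp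
  have "uniform_limit ?I (\<lambda>n s. poly (map_poly cnj (r n) * r n) (of_real s)) (\<lambda>s. cnj (h s) * h s) sequentially"
    unfolding poly_mult cnj_poly by (intro uniform_lim_mult uniform_limit_intros r bdd)
  then have "(\<lambda>n. poly_op A (map_poly cnj (r n) * r n) u) \<longlonglongrightarrow> C u"
    by (rule cont_calculus_tendsto[OF A C(1)])
  then have 1: "(\<lambda>n. complex_of_real ((norm (poly_op A (r n) u))\<^sup>2)) \<longlonglongrightarrow> cinner (C u) u"
    unfolding norm_poly_op_square[OF assms(1)] by (intro tendsto_intros)
  have "(\<lambda>n. poly_op A (r n) u) \<longlonglongrightarrow> F u - G u"
    unfolding r_def poly_op_diff
    by (intro tendsto_diff cont_calculus_tendsto[OF A f(1) q] cont_calculus_tendsto[OF A g(1) q'])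
  then have "(\<lambda>n. complex_of_real ((norm (poly_op A (r n) u))\<^sup>2)) \<longlonglongrightarrow> of_real ((norm (F u - G u))\<^sup>2)"
    by (intro tendsto_intros)
  with 1 have "cinner (C u) u = of_real ((norm (F u - G u))\<^sup>2)"
    by (rule LIMSEQ_unique)
  moreover have "cnj (h s) * h s = complex_of_real ((cmod (h s))\<^sup>2)" for s
    by (simp add: complex_norm_square mult.commute del: of_real_power)
  ultimately have "has_bochner_integral \<mu> (\<lambda>s. complex_of_real ((cmod (h s))\<^sup>2)) (of_real ((norm (F u - G u))\<^sup>2))"
    using C(2) by simp
  then have "has_bochner_integral \<mu> (\<lambda>s. (cmod (h s))\<^sup>2) ((norm (F u - G u))\<^sup>2)"
    using has_bochner_integral_Re by force
  then show ?thesis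
    unfolding h_def by (intro nn_integral_eq_integral[THEN trans])
      (auto simp: has_bochner_integral_iff)
qed

section \<open>Calculus with square integrable functions\<close>

lemma L2_calculus_one:
  assumes "psd A" "is_spectral_measure A u \<mu>" "is_L2_calculus A u \<mu> (\<lambda>_. 1) y"
  shows "y = u"
proof -
  obtain g G where g: "\<And>n. continuous_on UNIV (g n)" "\<And>n. is_cont_calculus A (g n) (G n)"
    "(\<lambda>n. \<integral>\<^sup>+ s. ennreal ((cmod (g n s - 1))\<^sup>2) \<partial>\<mu>) \<longlonglongrightarrow> 0" "(\<lambda>n. G n u) \<longlonglongrightarrow> y"
    using assms(3) unfolding is_L2_calculus_def by blast
  have A: "bounded_clinear A" using assms(1) by (simp add: psd_def)
  have "(\<lambda>n. ennreal ((norm (G n u - u))\<^sup>2)) \<longlonglongrightarrow> ennreal 0"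
    using g(3) spectral_measure_norm_diff[OF assms(1,2) g(2) g(1) spectral_measure_identity(1)[OF A assms(2)]]
    by simp
  then have "(\<lambda>n. (norm (G n u - u))\<^sup>2) \<longlonglongrightarrow> 0"
    by (rule tendsto_ennrealD) auto
  moreover have "(\<lambda>n. (norm (G n u - u))\<^sup>2) \<longlonglongrightarrow> (norm (y - u))\<^sup>2"
    by (intro tendsto_intros g)
  ultimately show ?thesis
    using LIMSEQ_unique by fastforce
qed

text \<open>The two vectors may come from different approximating sequences \<open>g\<close> and
  \<open>g'\<close>. Since both converge to \<open>f\<close> in the same \<open>L^2(\<mu>)\<close>,
  the isometry on the second side allows \<open>g'\<close> to be replaced by \<open>g\<close>, after
  which the pairs of approximants lie in \<open>W\<close>.\<close>

lemma L2_calculus_pairs: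
  assumes W: "pair_subspace W" "maps_pairs W (A \<circ> A) (A' \<circ> A')" "(u, v) \<in> W"
    and A: "psd A" and A': "psd A'"
    and \<mu>: "is_spectral_measure A u \<mu>" and \<mu>': "is_spectral_measure A' v \<mu>"
    and f [measurable]: "f \<in> borel_measurable borel"
    and x: "is_L2_calculus A u \<mu> f x" and y: "is_L2_calculus A' v \<mu> f y"
  shows "(x, y) \<in> W"
proof -
  have lin: "bounded_clinear A" "bounded_clinear A'" using A A' by (auto simp: psd_def)
  have [measurable_cong]: "sets \<mu> = sets borel" using \<mu> by (simp add: is_spectral_measure_def)
  obtain g G where g: "\<And>n. continuous_on UNIV (g n)" "\<And>n. is_cont_calculus A (g n) (G n)"
    "(\<lambda>n. \<integral>\<^sup>+ s. ennreal ((cmod (g n s - f s))\<^sup>2) \<partial>\<mu>) \<longlonglongrightarrow> 0" "(\<lambda>n. G n u) \<longlonglongrightarrow> x"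
    using x unfolding is_L2_calculus_def by blast
  obtain g' G' where g': "\<And>n. continuous_on UNIV (g' n)" "\<And>n. is_cont_calculus A' (g' n) (G' n)"
    "(\<lambda>n. \<integral>\<^sup>+ s. ennreal ((cmod (g' n s - f s))\<^sup>2) \<partial>\<mu>) \<longlonglongrightarrow> 0" "(\<lambda>n. G' n v) \<longlonglongrightarrow> y"
    using y unfolding is_L2_calculus_def by blast
  \<comment> \<open>\<open>K n\<close> is the first sequence evaluated at the second
    operator.\<close>
  have "\<exists>C. is_cont_calculus A' (g n) C" for n
    using \<mu>' g(1)[of n] unfolding is_spectral_measure_def by blast
  then obtain K where K: "\<And>n. is_cont_calculus A' (g n) (K n)"
    by metis
  have [measurable]: "g n \<in> borel_measurable borel" "g' n \<in> borel_measurable borel" for n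
    using g(1) g'(1) by (auto intro: borel_measurable_continuous_onI)
  have "(\<lambda>n. ennreal ((norm (K n v - G' n v))\<^sup>2)) \<longlonglongrightarrow> ennreal 0"
  proof (rule tendsto_sandwich[of "\<lambda>_. 0"])
    let ?b = "\<lambda>n. 2 * (\<integral>\<^sup>+ s. ennreal ((cmod (g n s - f s))\<^sup>2) \<partial>\<mu>)
        + 2 * (\<integral>\<^sup>+ s. ennreal ((cmod (g' n s - f s))\<^sup>2) \<partial>\<mu>)"
    have "?b \<longlonglongrightarrow> 2 * 0 + 2 * 0"
      by (intro tendsto_add ennreal_tendsto_cmult g g') auto
    then show "?b \<longlonglongrightarrow> ennreal 0" by simp
    have "ennreal ((norm (K n v - G' n v))\<^sup>2) \<le> ?b n" for n
    proof -
      have "ennreal ((norm (K n v - G' n v))\<^sup>2) = (\<integral>\<^sup>+ s. ennreal ((cmod (g n s - g' n s))\<^sup>2) \<partial>\<mu>)"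
        by (rule spectral_measure_norm_diff[OF A' \<mu>' K g(1) g'(2) g'(1), symmetric])
      also have "\<dots> \<le> (\<integral>\<^sup>+ s. 2 * ennreal ((cmod (g n s - f s))\<^sup>2) + 2 * ennreal ((cmod (g' n s - f s))\<^sup>2) \<partial>\<mu>)"
      proof (rule nn_integral_mono)
        fix s
        have "cmod (g n s - g' n s) \<le> cmod (g n s - f s) + cmod (g' n s - f s)"
          using norm_triangle_ineq4[of "g n s - f s" "g' n s - f s"] by simp
        then have "(cmod (g n s - g' n s))\<^sup>2 \<le> (cmod (g n s - f s) + cmod (g' n s - f s))\<^sup>2"
          by (rule power_mono) simp
        also have "\<dots> \<le> 2 * (cmod (g n s - f s))\<^sup>2 + 2 * (cmod (g' n s - f s))\<^sup>2"
          using sum_squares_bound[of "cmod (g n s - f s)" "cmod (g' n s - f s)"] by (simp add: power2_sum)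
        finally have "ennreal ((cmod (g n s - g' n s))\<^sup>2)
            \<le> ennreal (2 * (cmod (g n s - f s))\<^sup>2 + 2 * (cmod (g' n s - f s))\<^sup>2)"
          by (rule ennreal_leI)
        also have "\<dots> = 2 * ennreal ((cmod (g n s - f s))\<^sup>2) + 2 * ennreal ((cmod (g' n s - f s))\<^sup>2)"
          by (simp add: ennreal_mult)
        finally show "ennreal ((cmod (g n s - g' n s))\<^sup>2)
            \<le> 2 * ennreal ((cmod (g n s - f s))\<^sup>2) + 2 * ennreal ((cmod (g' n s - f s))\<^sup>2)" .
      qed
      also have "\<dots> = ?b n"
        by (subst nn_integral_add) (simp_all add: nn_integral_cmult)
      finally show ?thesis .
    qed
    then show "\<forall>\<^sub>F n in sequentially. ennreal ((norm (K n v - G' n v))\<^sup>2) \<le> ?b n" by simp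
  qed simp_all
  then have "(\<lambda>n. (norm (K n v - G' n v))\<^sup>2) \<longlonglongrightarrow> 0"
    by (rule tendsto_ennrealD) auto
  then have "(\<lambda>n. sqrt ((norm (K n v - G' n v))\<^sup>2)) \<longlonglongrightarrow> sqrt 0"
    by (rule tendsto_real_sqrt)
  then have "(\<lambda>n. K n v - G' n v) \<longlonglongrightarrow> 0"
    by (simp add: tendsto_norm_zero_iff)
  from tendsto_add[OF this g'(4)] have "(\<lambda>n. K n v) \<longlonglongrightarrow> y" by simp
  moreover have "(G n u, K n v) \<in> W" for n
    using maps_pairs_cont_calculus[OF W(1,2) lin g(2) K g(1)] W(3) by (rule maps_pairsD)
  ultimately show ?thesis
    by (rule pair_subspace_limit[OF W(1) g(4)])
qed

section \<open>Measures determined by continuous integrands\<close>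

lemma finite_borel_measure_eqI:
  fixes \<mu> \<nu> :: "real measure"
  assumes "finite_measure \<mu>" "finite_measure \<nu>"
    and sets: "sets \<mu> = sets borel" "sets \<nu> = sets borel"
    and eq: "\<And>f. continuous_on UNIV f \<Longrightarrow>
      (\<integral>s. f s \<partial>\<mu>) = ((\<integral>s. f s \<partial>\<nu>) :: complex)"
  shows "\<mu> = \<nu>"
proof -
  interpret \<mu>: finite_measure \<mu> by fact
  interpret \<nu>: finite_measure \<nu> by fact
  \<comment> \<open>For positive \<open>n\<close> this cutoff is 1 up to \<open>a\<close>, falls
    with slope \<open>-n\<close>, and vanishes from \<open>a + 1/n\<close> on. The limit is the
    indicator of the closed half-line, and half-lines generate the Borel sets.\<close>
  define \<phi> where "\<phi> a n s = complex_of_real (max 0 (min 1 (1 - real n * (s - a))))" for a s and n :: nat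
  have cont: "continuous_on UNIV (\<phi> a n)" for a n
    unfolding \<phi>_def by (intro continuous_intros)
  then have [measurable]: "\<phi> a n \<in> borel_measurable borel" for a n
    by (rule borel_measurable_continuous_onI)
  have "(\<lambda>n. \<phi> a n s) \<longlonglongrightarrow> indicat_real {..a} s" for a s
  proof (cases "s \<le> a")
    case True
    then have "\<phi> a n s = 1" for n
      by (simp add: \<phi>_def mult_nonneg_nonpos)
    with True show ?thesis by simp
  next
    case False
    obtain N where N: "1 / (s - a) < real N" using reals_Archimedean2 by blast
    have "\<phi> a n s = 0" if "n \<ge> N" for n
    proof -
      have "1 < real N * (s - a)" using False N by (simp add: field_simps)
      also have "\<dots> \<le> real n * (s - a)" using False that by (intro mult_right_mono) auto
      finally show ?thesis by (simp add: \<phi>_def)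
    qed
    then have "(\<lambda>n. \<phi> a n s) \<longlonglongrightarrow> 0"
      by (intro tendsto_eventually eventually_sequentiallyI)
    with False show ?thesis by simp
  qed
  then have lim: "(\<lambda>n. \<integral>s. \<phi> a n s \<partial>M) \<longlonglongrightarrow> complex_of_real (measure M {..a})"
    if "finite_measure M" "sets M = sets borel" for M a
  proof -
    interpret finite_measure M by fact
    note that(2)[measurable_cong]
    have "(\<lambda>n. \<integral>s. \<phi> a n s \<partial>M) \<longlonglongrightarrow> (\<integral>s. complex_of_real (indicat_real {..a} s) \<partial>M)"
      by (rule integral_dominated_convergence[where w = "\<lambda>_. 1"])
        (use \<open>\<And>s a. (\<lambda>n. \<phi> a n s) \<longlonglongrightarrow> _\<close> in \<open>auto simp: \<phi>_def\<close>)
    also have "space M = UNIV" using sets_eq_imp_space_eq[OF that(2)] by simp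
    then have "(\<integral>s. complex_of_real (indicat_real {..a} s) \<partial>M) = complex_of_real (measure M {..a})"
      by (simp add: integral_complex_of_real)
    finally show ?thesis .
  qed
  have measure_eq: "measure \<mu> {..a} = measure \<nu> {..a}" for a
  proof -
    have "(\<lambda>n. \<integral>s. \<phi> a n s \<partial>\<nu>) \<longlonglongrightarrow> complex_of_real (measure \<mu> {..a})"
      using lim[OF assms(1) sets(1), of a] by (simp add: eq[OF cont])
    from LIMSEQ_unique[OF this lim[OF assms(2) sets(2)]] show ?thesis by simp
  qed
  show ?thesis
  proof (rule measure_eqI_generator_eq[where \<Omega> = UNIV and E = "range atMost" and A = "\<lambda>i::nat. {..real i}"])
    show "Int_stable (range atMost :: real set set)"
      by (auto simp: Int_stable_def)
    show "emeasure \<mu> X = emeasure \<nu> X" if "X \<in> range atMost" for X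
      using that measure_eq by (auto simp: \<mu>.emeasure_eq_measure \<nu>.emeasure_eq_measure)
    show "sets \<mu> = sigma_sets UNIV (range atMost)" "sets \<nu> = sigma_sets UNIV (range atMost)"
      unfolding sets borel_eq_atMost by (simp_all add: sets_measure_of)
    show "(\<Union>i::nat. {..real i}) = UNIV"
      using real_arch_simple by auto
  qed (auto simp: \<mu>.emeasure_eq_measure)
qed


section \<open>Trigonometric polynomials are dense\<close>

definition closed_csubspace :: "'a::complex_inner set \<Rightarrow> bool" where
  "closed_csubspace X \<longleftrightarrow> closed X \<and> 0 \<in> X \<and> (\<forall>x\<in>X. \<forall>y\<in>X. x + y \<in> X) \<and> (\<forall>c. \<forall>x\<in>X. c *\<^sub>C x \<in> X)"

lemma closed_csubspaceD:
  assumes "closed_csubspace X"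
  shows "closed X" "0 \<in> X" "x \<in> X \<Longrightarrow> y \<in> X \<Longrightarrow> x + y \<in> X" "x \<in> X \<Longrightarrow> c *\<^sub>C x \<in> X"
  using assms by (auto simp: closed_csubspace_def)

lemma closed_csubspace_closure:
  assumes "0 \<in> X" "\<And>x y. x \<in> X \<Longrightarrow> y \<in> X \<Longrightarrow> x + y \<in> X" "\<And>c x. x \<in> X \<Longrightarrow> c *\<^sub>C x \<in> X"
  shows "closed_csubspace (closure X)"
  unfolding closed_csubspace_def
proof (intro conjI ballI allI)
  show "closed (closure X)" by simp
  show "0 \<in> closure X" using assms(1) closure_subset by blast
next
  fix x y assume "x \<in> closure X" "y \<in> closure X"
  then obtain f g where fg: "\<And>n. f n \<in> X" "f \<longlonglongrightarrow> x" "\<And>n. g n \<in> X" "g \<longlonglongrightarrow> y"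
    unfolding closure_sequential by blast
  then have "(\<lambda>n. f n + g n) \<longlonglongrightarrow> x + y" "\<And>n. f n + g n \<in> X"
    by (auto intro: tendsto_add assms)
  then show "x + y \<in> closure X" unfolding closure_sequential by (intro exI[of _ "\<lambda>n. f n + g n"]) blast
next
  fix c and x assume "x \<in> closure X"
  then obtain f where f: "\<And>n. f n \<in> X" "f \<longlonglongrightarrow> x"
    unfolding closure_sequential by blast
  then have "(\<lambda>n. c *\<^sub>C f n) \<longlonglongrightarrow> c *\<^sub>C x" "\<And>n. c *\<^sub>C f n \<in> X"
    by (auto intro: tendsto_scaleC assms)
  then show "c *\<^sub>C x \<in> closure X" unfolding closure_sequential by (intro exI[of _ "\<lambda>n. c *\<^sub>C f n"]) blast
qed

section \<open>Square integrable functions and their classes\<close>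

lemma square_integrable_l2_fun: "square_integrable circle (l2_fun x)"
  using Quotient_rep_reflp[OF Quotient_l2_circle, of x] by (simp add: l2_eq_def)

lemma borel_measurable_l2_fun [measurable]: "l2_fun x \<in> borel_measurable borel"
  using square_integrable_l2_fun[of x] by (auto simp: square_integrable_def)

lemma l2_of_l2_fun [simp]: "l2_of (l2_fun x) = x"
  by (rule Quotient_abs_rep[OF Quotient_l2_circle])

lemma AE_l2_fun_l2_of:
  assumes "square_integrable circle f" shows "AE z in circle. l2_fun (l2_of f) z = f z"
  using Quotient_rep_abs[OF Quotient_l2_circle, of f] assms by (simp add: l2_eq_def)

lemma l2_of_cong:
  assumes "square_integrable circle f" "square_integrable circle g" "AE z in circle. f z = g z"
  shows "l2_of f = l2_of g"
  using Quotient_rel_abs[OF Quotient_l2_circle, of f g] assms by (simp add: l2_eq_def)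

lemma l2_of_add:
  assumes "square_integrable circle f" "square_integrable circle g"
  shows "l2_of f + l2_of g = l2_of (\<lambda>z. f z + g z)"
  using assms by (intro plus_l2_circle.abs_eq) (simp_all add: l2_eq_def)

lemma l2_of_scaleC:
  assumes "square_integrable circle f" shows "c *\<^sub>C l2_of f = l2_of (\<lambda>z. c * f z)"
  using assms by (intro scaleC_l2_circle.abs_eq) (simp add: l2_eq_def)

lemma norm_l2_of_diff:
  assumes "square_integrable circle f" "square_integrable circle g"
  shows "(norm (l2_of f - l2_of g))\<^sup>2 = (\<integral>z. (cmod (f z - g z))\<^sup>2 \<partial>circle)"
proof -
  have g: "square_integrable circle (\<lambda>z. - 1 * g z)"
    by (rule square_integrable_cmult) fact
  have "l2_of f - l2_of g = l2_of f + (- 1) *\<^sub>C l2_of g" by simp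
  also have "\<dots> = l2_of (\<lambda>z. f z - g z)"
    by (simp only: l2_of_scaleC[OF assms(2)] l2_of_add[OF assms(1) g]) simp
  finally have *: "l2_of f - l2_of g = l2_of (\<lambda>z. f z - g z)" .
  have "square_integrable circle (\<lambda>z. f z - g z)"
    using square_integrable_add[OF assms(1) g] by simp
  then have "cinner (l2_of (\<lambda>z. f z - g z)) (l2_of (\<lambda>z. f z - g z))
      = complex_of_real (\<integral>z. (cmod (f z - g z))\<^sup>2 \<partial>circle)"
    unfolding integral_mult_cnj_self[symmetric]
    by (intro cinner_l2_circle.abs_eq) (simp_all add: l2_eq_def)
  then show ?thesis
    unfolding * cinner_self of_real_eq_iff .
qed

text \<open>Regularity is put in terms of a set difference because that is what the
  \<open>L^2\<close> distance between an indicator and a cutoff function sees.\<close>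

lemma outer_regular_approx:
  fixes M :: "'a::{second_countable_topology, complete_space} measure"
  assumes "finite_measure M" "sets M = sets borel" "B \<in> sets borel" "e > 0"
  obtains U where "open U" "B \<subseteq> U" "measure M (U - B) < e"
proof -
  interpret finite_measure M by fact
  have "emeasure M B < emeasure M B + ennreal e"
    using assms(4) by (simp add: emeasure_eq_measure ennreal_less_iff flip: ennreal_plus)
  then have "(INF U \<in> {U. B \<subseteq> U \<and> open U}. emeasure M U) < emeasure M B + ennreal e"
    using outer_regular[OF assms(2) _ assms(3)] emeasure_finite by simp
  then obtain U where U: "B \<subseteq> U" "open U" "emeasure M U < emeasure M B + ennreal e"
    unfolding INF_less_iff by auto
  have "measure M U < measure M B + e"
    using U(3) assms(4) by (simp add: emeasure_eq_measure ennreal_less_iff flip: ennreal_plus)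
  moreover have "measure M (U - B) = measure M U - measure M B"
    by (rule finite_measure_Diff) (use U assms in auto)
  ultimately show ?thesis using U that by force
qed

section \<open>Multiplication operators on the circle\<close>

lift_definition l2_mult_cnj_z :: "l2_circle \<Rightarrow> l2_circle" is "\<lambda>f z. cnj z * f z"
proof -
  have "AE z in circle. cmod (cnj z) \<le> 1"
    using AE_circle by eventually_elim simp
  moreover have "cnj \<in> borel_measurable borel"
    using borel_measurable_cnj'[OF measurable_ident_sets[OF refl]] by (simp add: id_def)
  ultimately show "l2_eq (\<lambda>z. cnj z * f z) (\<lambda>z. cnj z * g z)" if "l2_eq f g" for f g
    using that by (auto simp: l2_eq_def intro!: square_integrable_bounded_mult[where h = cnj])
qed

lemma cinner_l2_mult_z: "cinner (l2_mult_z f) g = cinner f (l2_mult_cnj_z g)"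
  by transfer (simp add: mult_ac)

text \<open>The relation \<open>z * cnj z = 1\<close> holds only almost everywhere, so the classes
  are compared through their inner products with all \<open>g\<close>.\<close>

lemma l2_mult_z_cnj_z [simp]:
  "l2_mult_z (l2_mult_cnj_z f) = f" "l2_mult_cnj_z (l2_mult_z f) = f"
proof -
  have *: "AE z in circle. z * (cnj z * h z) = h z" for h
    using AE_circle by eventually_elim (simp add: mult.assoc[symmetric] complex_norm_square[symmetric])
  show "l2_mult_z (l2_mult_cnj_z f) = f"
  proof (rule cinner_ext)
    fix g show "cinner (l2_mult_z (l2_mult_cnj_z f)) g = cinner f g"
    proof transfer
      fix f g assume fg: "l2_eq f f" "l2_eq g g"
      then have [measurable]: "f \<in> borel_measurable borel" "g \<in> borel_measurable borel"
        by (auto simp: l2_eq_def square_integrable_def)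
      show "(\<integral>z. z * (cnj z * f z) * cnj (g z) \<partial>circle) = (\<integral>z. f z * cnj (g z) \<partial>circle)"
        by (rule integral_cong_AE) (use *[of f] in auto)
    qed
  qed
  show "l2_mult_cnj_z (l2_mult_z f) = f"
  proof (rule cinner_ext)
    fix g show "cinner (l2_mult_cnj_z (l2_mult_z f)) g = cinner f g"
    proof transfer
      fix f g assume fg: "l2_eq f f" "l2_eq g g"
      then have [measurable]: "f \<in> borel_measurable borel" "g \<in> borel_measurable borel"
        by (auto simp: l2_eq_def square_integrable_def)
      show "(\<integral>z. cnj z * (z * f z) * cnj (g z) \<partial>circle) = (\<integral>z. f z * cnj (g z) \<partial>circle)"
        by (rule integral_cong_AE) (use *[of f] in \<open>auto simp: mult_ac\<close>)
    qed
  qed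
qed

text \<open>Multipliers of a closed subspace are closed under products for trivial reasons, which
  replaces any computation with products of trigonometric polynomials.\<close>

definition multiplier :: "l2_circle set \<Rightarrow> (complex \<Rightarrow> complex) \<Rightarrow> bool" where
  "multiplier X h \<longleftrightarrow> h \<in> borel_measurable borel \<and> (\<exists>C. \<forall>z. cmod z = 1 \<longrightarrow> cmod (h z) \<le> C) \<and>
     (\<forall>x\<in>X. l2_of (\<lambda>z. h z * l2_fun x z) \<in> X)"

lemma square_integrable_mult_l2_fun:
  assumes "h \<in> borel_measurable borel" "\<forall>z. cmod z = 1 \<longrightarrow> cmod (h z) \<le> C"
  shows "square_integrable circle (\<lambda>z. h z * l2_fun x z)"
proof (rule square_integrable_bounded_mult[OF square_integrable_l2_fun assms(1)])
  show "AE z in circle. cmod (h z) \<le> C"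
    using AE_circle by eventually_elim (use assms(2) in blast)
qed

lemma multiplierD:
  assumes "multiplier X h"
  shows "h \<in> borel_measurable borel" "x \<in> X \<Longrightarrow> l2_of (\<lambda>z. h z * l2_fun x z) \<in> X"
    "square_integrable circle (\<lambda>z. h z * l2_fun x z)"
  using assms square_integrable_mult_l2_fun by (auto simp: multiplier_def)

lemma multiplier_const: "closed_csubspace X \<Longrightarrow> multiplier X (\<lambda>_. c)"
  unfolding multiplier_def
  by (auto simp flip: l2_of_scaleC[OF square_integrable_l2_fun] intro: closed_csubspaceD)

lemma multiplier_add:
  assumes X: "closed_csubspace X" and g: "multiplier X g" and h: "multiplier X h"
  shows "multiplier X (\<lambda>z. g z + h z)"
  unfolding multiplier_def
proof (intro conjI ballI)
  show "(\<lambda>z. g z + h z) \<in> borel_measurable borel"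
    using multiplierD(1)[OF g] multiplierD(1)[OF h] by measurable
  obtain C D where "\<forall>z. cmod z = 1 \<longrightarrow> cmod (g z) \<le> C" "\<forall>z. cmod z = 1 \<longrightarrow> cmod (h z) \<le> D"
    using g h by (auto simp: multiplier_def)
  then show "\<exists>C. \<forall>z. cmod z = 1 \<longrightarrow> cmod (g z + h z) \<le> C"
    by (intro exI[of _ "C + D"]) (meson add_mono norm_triangle_le)
  fix x assume "x \<in> X"
  then show "l2_of (\<lambda>z. (g z + h z) * l2_fun x z) \<in> X"
    using closed_csubspaceD(3)[OF X multiplierD(2)[OF g] multiplierD(2)[OF h], of x x]
    by (simp add: l2_of_add multiplierD(3)[OF g] multiplierD(3)[OF h] distrib_right)
qed

lemma multiplier_mult:
  assumes g: "multiplier X g" and h: "multiplier X h"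
  shows "multiplier X (\<lambda>z. g z * h z)"
  unfolding multiplier_def
proof (intro conjI ballI)
  show m: "(\<lambda>z. g z * h z) \<in> borel_measurable borel"
    using multiplierD(1)[OF g] multiplierD(1)[OF h] by measurable
  obtain C D where CD: "\<forall>z. cmod z = 1 \<longrightarrow> cmod (g z) \<le> C" "\<forall>z. cmod z = 1 \<longrightarrow> cmod (h z) \<le> D"
    using g h by (auto simp: multiplier_def)
  have bound: "cmod (g z * h z) \<le> C * D" if "cmod z = 1" for z
    using CD that order_trans[OF norm_ge_zero[of "g z"]] unfolding norm_mult
    by (intro mult_mono) auto
  then show "\<exists>C. \<forall>z. cmod z = 1 \<longrightarrow> cmod (g z * h z) \<le> C" by blast
  fix x assume x: "x \<in> X"
  let ?y = "l2_of (\<lambda>z. h z * l2_fun x z)"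
  \<comment> \<open>\<open>l2_fun\<close> returns just one representative of the class
    \<open>?y\<close>, so the two products agree only almost everywhere.\<close>
  have "l2_of (\<lambda>z. g z * l2_fun ?y z) = l2_of (\<lambda>z. g z * h z * l2_fun x z)"
  proof (rule l2_of_cong)
    show "square_integrable circle (\<lambda>z. g z * h z * l2_fun x z)"
      by (rule square_integrable_mult_l2_fun[OF m]) (use bound in blast)
    show "AE z in circle. g z * l2_fun ?y z = g z * h z * l2_fun x z"
      using AE_l2_fun_l2_of[OF multiplierD(3)[OF h, of x]] by eventually_elim simp
  qed (rule multiplierD(3)[OF g])
  then show "l2_of (\<lambda>z. g z * h z * l2_fun x z) \<in> X"
    using multiplierD(2)[OF g multiplierD(2)[OF h x]] by simp
qed

lemma multiplier_uniform_limit: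
  assumes X: "closed_csubspace X" and h: "h \<in> borel_measurable borel"
    and approx: "\<And>e. e > 0 \<Longrightarrow> \<exists>g. multiplier X g \<and> (\<forall>z. cmod z = 1 \<longrightarrow> cmod (h z - g z) \<le> e)"
  shows "multiplier X h"
  unfolding multiplier_def
proof (intro conjI ballI h)
  obtain g C where "\<forall>z. cmod z = 1 \<longrightarrow> cmod (g z) \<le> C" "\<forall>z. cmod z = 1 \<longrightarrow> cmod (h z - g z) \<le> 1"
    using approx[of 1] by (auto simp: multiplier_def)
  then have bound: "cmod (h z) \<le> C + 1" if "cmod z = 1" for z
    using that norm_triangle_sub[of "h z" "g z"] by fastforce
  then show "\<exists>C. \<forall>z. cmod z = 1 \<longrightarrow> cmod (h z) \<le> C" by blast
  fix x assume x: "x \<in> X"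
  have hx: "square_integrable circle (\<lambda>z. h z * l2_fun x z)"
    by (rule square_integrable_mult_l2_fun[OF h]) (use bound in blast)
  have x0: "square_integrable circle (\<lambda>z. 0 * l2_fun x z)"
    by (rule square_integrable_cmult[OF square_integrable_l2_fun])
  let ?I = "\<integral>z. (cmod (l2_fun x z))\<^sup>2 \<partial>circle"
  have int: "integrable circle (\<lambda>z. (cmod (l2_fun x z))\<^sup>2)"
    using square_integrable_l2_fun by (simp add: square_integrable_def)
  have "l2_of (\<lambda>z. h z * l2_fun x z) \<in> closure X"
    unfolding closure_approachable
  proof (intro allI impI)
    fix e :: real assume e: "e > 0"
    \<comment> \<open>A uniform error \<open>d\<close> costs at most \<open>d * sqrt ?I\<close>,
      where \<open>?I\<close> is the squared norm of \<open>x\<close>. The summand 1 avoids a zero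
      denominator and makes the final inequality strict.\<close>
    define d where "d = e / (1 + sqrt ?I)"
    have pos: "1 + sqrt ?I > 0" by (intro add_pos_nonneg real_sqrt_ge_zero) simp_all
    then have d: "d > 0" using e by (simp add: d_def)
    then obtain g where g: "multiplier X g" "\<forall>z. cmod z = 1 \<longrightarrow> cmod (h z - g z) \<le> d"
      using approx by blast
    note [measurable] = multiplierD(1)[OF g(1)] h
    let ?y = "l2_of (\<lambda>z. g z * l2_fun x z)"
    have "(norm (l2_of (\<lambda>z. h z * l2_fun x z) - ?y))\<^sup>2
        = (\<integral>z. (cmod (h z * l2_fun x z - g z * l2_fun x z))\<^sup>2 \<partial>circle)"
      by (rule norm_l2_of_diff[OF hx multiplierD(3)[OF g(1)]])
    also have "\<dots> \<le> (\<integral>z. d\<^sup>2 * (cmod (l2_fun x z))\<^sup>2 \<partial>circle)"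
    proof (rule integral_mono_AE')
      show "integrable circle (\<lambda>z. d\<^sup>2 * (cmod (l2_fun x z))\<^sup>2)" using int by simp
      show "AE z in circle. (cmod (h z * l2_fun x z - g z * l2_fun x z))\<^sup>2 \<le> d\<^sup>2 * (cmod (l2_fun x z))\<^sup>2"
        using AE_circle
      proof eventually_elim
        case (elim z)
        then have "cmod (h z - g z) \<le> d" using g(2) by blast
        then have "cmod (h z - g z) * cmod (l2_fun x z) \<le> d * cmod (l2_fun x z)"
          by (rule mult_right_mono) simp
        then have "(cmod ((h z - g z) * l2_fun x z))\<^sup>2 \<le> (d * cmod (l2_fun x z))\<^sup>2"
          unfolding norm_mult by (rule power_mono) simp
        then show ?case by (simp add: power_mult_distrib left_diff_distrib)
      qed
    qed simp_all
    also have "\<dots> = (d * sqrt ?I)\<^sup>2" by (simp add: power_mult_distrib)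
    finally have "norm (l2_of (\<lambda>z. h z * l2_fun x z) - ?y) \<le> d * sqrt ?I"
      by (rule power2_le_imp_le) (use d in simp)
    also have "\<dots> < d * (1 + sqrt ?I)" using d by simp
    also have "\<dots> = e" using pos by (simp add: d_def)
    finally show "\<exists>y\<in>X. dist y (l2_of (\<lambda>z. h z * l2_fun x z)) < e"
      using multiplierD(2)[OF g(1) x] by (auto simp: dist_norm norm_minus_commute)
  qed
  then show "l2_of (\<lambda>z. h z * l2_fun x z) \<in> X"
    using closed_csubspaceD(1)[OF X] by simp
qed

text \<open>Real polynomial functions on the plane are built from real-linear functionals, and each
  of those is a combination of \<open>z\<close> and \<open>cnj z\<close>; sums and products of
  multipliers do the rest.\<close>

lemma multiplier_real_polynomial:
  assumes X: "closed_csubspace X" and "multiplier X (\<lambda>z. z)" "multiplier X cnj"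
    and "real_polynomial_function q"
  shows "multiplier X (\<lambda>z. of_real (q z))"
  using assms(4)
proof induction
  case (linear f)
  have z: "z = Re z *\<^sub>R 1 + Im z *\<^sub>R \<i>" for z by (simp add: complex_eq_iff)
  \<comment> \<open>These come from \<open>Re z = (z + cnj z) / 2\<close> and
    \<open>Im z = - \<i> (z - cnj z) / 2\<close>.\<close>
  define a b where "a = complex_of_real (f 1) * (1 / 2)" and "b = complex_of_real (f \<i>) * (- \<i> / 2)"
  have f: "f z = Re z * f 1 + Im z * f \<i>" for z
    by (subst z) (simp only: linear_simps[OF linear] real_scaleR_def)
  have "complex_of_real (f z) = a * (z + cnj z) + b * (z + (- 1) * cnj z)" for z
    using f[of z] unfolding a_def b_def by (simp add: complex_eq_iff)
  moreover have "multiplier X (\<lambda>z. a * (z + cnj z) + b * (z + (- 1) * cnj z))"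
    by (intro multiplier_add[OF X] multiplier_mult multiplier_const[OF X] assms(2,3))
  ultimately show ?case by simp
next
  case (const c)
  show ?case by (rule multiplier_const[OF X])
qed (simp_all add: multiplier_add[OF X] multiplier_mult)

lemma l2_of_one: "l2_of (\<lambda>_. 1) = l2_monom 0"
proof -
  have "l2_monom 0 = l2_of (\<lambda>z. z powi 0)" by (rule l2_monom.abs_eq)
  then show ?thesis by simp
qed

lemma square_integrable_bounded_function:
  assumes "h \<in> borel_measurable borel" "\<And>z. cmod (h z) \<le> C"
  shows "square_integrable circle h"
  by (rule square_integrable_circle_bounded[OF assms(1), of C]) (simp add: assms(2))

section \<open>From continuous functions to the whole of \<open>L^2\<close>\<close>

context
  fixes X :: "l2_circle set"
  assumes X: "closed_csubspace X" and one: "l2_monom 0 \<in> X"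
    and mult_z: "\<And>x. x \<in> X \<Longrightarrow> l2_mult_z x \<in> X"
    and mult_cnj_z: "\<And>x. x \<in> X \<Longrightarrow> l2_mult_cnj_z x \<in> X"
begin

text \<open>Stone-Weierstrass on the unit circle makes \<open>h\<close> a uniform limit of
  multipliers, hence a multiplier itself; applying it to the constant 1 puts \<open>h\<close> into
  \<open>X\<close>.\<close>

lemma continuous_in_subspace:
  fixes h :: "complex \<Rightarrow> real"
  assumes "continuous_on UNIV h"
  shows "l2_of (\<lambda>z. of_real (h z)) \<in> X"
proof -
  have m: "(\<lambda>z. complex_of_real (h z)) \<in> borel_measurable borel"
    using assms by (intro borel_measurable_continuous_onI continuous_intros)
  have z: "multiplier X (\<lambda>z. z)"
    unfolding multiplier_def
  proof (intro conjI ballI exI[of _ 1])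
    fix x assume "x \<in> X"
    moreover have "l2_mult_z x = l2_of (\<lambda>z. z * l2_fun x z)"
      using l2_mult_z.abs_eq[of "l2_fun x"] square_integrable_l2_fun by (simp add: l2_eq_def)
    ultimately show "l2_of (\<lambda>z. z * l2_fun x z) \<in> X" using mult_z by metis
  qed auto
  have cnj_z: "multiplier X cnj"
    unfolding multiplier_def
  proof (intro conjI ballI exI[of _ 1])
    show "cnj \<in> borel_measurable borel"
      using borel_measurable_cnj'[OF measurable_ident_sets[OF refl]] by (simp add: id_def)
    fix x assume "x \<in> X"
    moreover have "l2_mult_cnj_z x = l2_of (\<lambda>z. cnj z * l2_fun x z)"
      using l2_mult_cnj_z.abs_eq[of "l2_fun x"] square_integrable_l2_fun by (simp add: l2_eq_def)
    ultimately show "l2_of (\<lambda>z. cnj z * l2_fun x z) \<in> X" using mult_cnj_z by metis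
  qed auto
  have "multiplier X (\<lambda>z. of_real (h z))"
  proof (rule multiplier_uniform_limit[OF X m])
    fix e :: real assume "e > 0"
    have cont: "continuous_on (sphere 0 1) h"
      using assms by (rule continuous_on_subset) simp
    obtain q where q: "real_polynomial_function q" "\<And>z. z \<in> sphere 0 1 \<Longrightarrow> \<bar>h z - q z\<bar> < e"
      using Stone_Weierstrass_real_polynomial_function[OF compact_sphere cont \<open>e > 0\<close>] by blast
    then show "\<exists>g. multiplier X g \<and> (\<forall>z. cmod z = 1 \<longrightarrow> cmod (of_real (h z) - g z) \<le> e)"
      using multiplier_real_polynomial[OF X z cnj_z q(1)]
      by (intro exI[of _ "\<lambda>z. of_real (q z)"]) (auto simp flip: of_real_diff intro: less_imp_le)
  qed
  note * = multiplierD(2,3)[OF this, of "l2_monom 0"]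
  have 1: "square_integrable circle (\<lambda>_. 1)"
    by (rule square_integrable_bounded_function[of _ 1]) auto
  obtain C where C: "\<And>z. cmod z = 1 \<Longrightarrow> \<bar>h z\<bar> \<le> C"
  proof -
    have "continuous_on (sphere 0 1) h"
      using assms by (rule continuous_on_subset) simp
    then have "bounded (h ` sphere 0 1)"
      by (intro compact_imp_bounded compact_continuous_image) auto
    then obtain C where "\<forall>x\<in>sphere 0 1. \<bar>h x\<bar> \<le> C" by (auto simp: bounded_iff)
    then show ?thesis by (intro that[of C]) simp
  qed
  have "square_integrable circle (\<lambda>z. complex_of_real (h z))"
  proof (rule square_integrable_circle_bounded[OF m])
    show "AE z in circle. cmod (complex_of_real (h z)) \<le> C"
      using AE_circle by eventually_elim (simp add: C)
  qed
  then have "l2_of (\<lambda>z. of_real (h z) * l2_fun (l2_monom 0) z) = l2_of (\<lambda>z. of_real (h z))"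
  proof (rule l2_of_cong[OF *(2)])
    show "AE z in circle. of_real (h z) * l2_fun (l2_monom 0) z = of_real (h z)"
      using AE_l2_fun_l2_of[OF 1] unfolding l2_of_one by eventually_elim simp
  qed
  with *(1)[OF one] show ?thesis by simp
qed

text \<open>\<open>B\<close> is squeezed between a closed and an open set of nearly equal measure. A
  Urysohn function for them differs from the indicator of \<open>B\<close> only on the small set
  between the two.\<close>

lemma indicator_in_subspace:
  assumes B: "B \<in> sets borel" shows "l2_of (indicator B) \<in> X"
proof -
  have "l2_of (indicator B) \<in> closure X"
    unfolding closure_approachable
  proof (intro allI impI)
    fix e :: real assume "e > 0"
    then have e: "e\<^sup>2 / 2 > 0" by simp
    obtain U where U: "open U" "B \<subseteq> U" "measure circle (U - B) < e\<^sup>2 / 2"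
      using outer_regular_approx[OF circle.finite_measure_axioms sets_circle B e] by blast
    \<comment> \<open>Outer regularity of the complement: the closed set \<open>- V\<close>
      approximates \<open>B\<close> from inside.\<close>
    obtain V where V: "open V" "- B \<subseteq> V" "measure circle (V - - B) < e\<^sup>2 / 2"
      using outer_regular_approx[OF circle.finite_measure_axioms sets_circle _ e, of "- B"] B
      by (metis borel_comp)
    have "closed (- V)" "closed (- U)" "- V \<inter> - U = {}"
      using U V by auto
    from Urysohn[OF this, of 1 0] obtain h :: "complex \<Rightarrow> real" where h: "continuous_on UNIV h"
      "\<And>z. h z \<in> closed_segment 1 0" "\<And>z. z \<in> - V \<Longrightarrow> h z = 1" "\<And>z. z \<in> - U \<Longrightarrow> h z = 0"
      by blast
    have h01: "0 \<le> h z" "h z \<le> 1" for z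
      using h(2)[of z] by (auto simp: closed_segment_eq_real_ivl)
    have [measurable]: "B \<in> sets borel" "U \<in> sets borel" "V \<in> sets borel" "h \<in> borel_measurable borel"
      using B U V h(1) by (auto intro: borel_measurable_continuous_onI)
    have "(norm (l2_of (indicator B) - l2_of (\<lambda>z. of_real (h z))))\<^sup>2
        = (\<integral>z. (cmod (indicator B z - of_real (h z)))\<^sup>2 \<partial>circle)"
      by (rule norm_l2_of_diff; rule square_integrable_bounded_function[of _ 1])
        (use h01 in \<open>auto simp: indicator_def\<close>)
    also have "\<dots> \<le> (\<integral>z. indicat_real (U - B) z + indicat_real (V - - B) z \<partial>circle)"
    proof (rule integral_mono')
      show "integrable circle (\<lambda>z. indicat_real (U - B) z + indicat_real (V - - B) z)"
        by (intro Bochner_Integration.integrable_add circle.integrable_const_bound[where B = 1])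
          (auto simp: indicator_def)
      fix z
      have "(cmod (indicator B z - of_real (h z)))\<^sup>2 = (indicat_real B z - h z)\<^sup>2"
        by (simp add: indicator_def cmod_power2)
      also have "\<dots> \<le> indicat_real (U - B) z + indicat_real (V - - B) z"
      proof (cases "z \<in> B")
        case True
        then show ?thesis
          using h(3)[of z] h01[of z] U(2) by (auto simp: indicator_def power_le_one)
      next
        case False
        then show ?thesis
          using h(4)[of z] h01[of z] V(2) by (auto simp: indicator_def power_le_one)
      qed
      finally show "(cmod (indicator B z - of_real (h z)))\<^sup>2 \<le> indicat_real (U - B) z + indicat_real (V - - B) z" .
    qed simp_all
    also have "\<dots> = measure circle (U - B) + measure circle (V - - B)"
      by (subst Bochner_Integration.integral_add)
        (auto intro!: circle.integrable_const_bound[where B = 1])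
    also have "\<dots> < e\<^sup>2" using U V by simp
    finally have "norm (l2_of (indicator B) - l2_of (\<lambda>z. of_real (h z))) < e"
      by (rule power2_less_imp_less) (use \<open>e > 0\<close> in simp)
    then show "\<exists>y\<in>X. dist y (l2_of (indicator B)) < e"
      using continuous_in_subspace[OF h(1)]
      by (intro bexI[of _ "l2_of (\<lambda>z. of_real (h z))"]) (simp_all add: dist_norm norm_minus_commute)
  qed
  then show ?thesis using closed_csubspaceD(1)[OF X] by simp
qed

lemma simple_in_subspace:
  assumes "simple_function circle f" shows "square_integrable circle f" "l2_of f \<in> X"
proof -
  have sum: "square_integrable circle (\<lambda>z. \<Sum>y\<in>S. y * indicator (f -` {y}) z) \<and>
      l2_of (\<lambda>z. \<Sum>y\<in>S. y * indicator (f -` {y}) z) \<in> X" if "finite S" for S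
    using that
  proof induction
    case empty
    have "square_integrable circle (\<lambda>_. 0)"
      by (rule square_integrable_bounded_function[of _ 1]) auto
    moreover have "l2_of (\<lambda>_. 0) = 0" by (simp add: zero_l2_circle.abs_eq)
    ultimately show ?case using closed_csubspaceD(2)[OF X] by simp
  next
    case (insert y S)
    have B: "f -` {y} \<in> sets borel"
      using borel_measurable_vimage[OF borel_measurable_simple_function[OF assms], of y] by simp
    have 1: "square_integrable circle (indicator (f -` {y}))"
      by (rule square_integrable_bounded_function[of _ 1]) (use B in \<open>auto simp: indicator_def\<close>)
    have "y *\<^sub>C l2_of (indicator (f -` {y})) + l2_of (\<lambda>z. \<Sum>y\<in>S. y * indicator (f -` {y}) z) \<in> X"
      by (intro closed_csubspaceD[OF X] indicator_in_subspace[OF B] insert.IH[THEN conjunct2])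
    moreover have "square_integrable circle (\<lambda>z. y * indicator (f -` {y}) z)"
      by (rule square_integrable_cmult[OF 1])
    ultimately show ?case
      using insert.IH insert.hyps
      by (simp only: l2_of_scaleC[OF 1] l2_of_add sum.insert square_integrable_add simp_thms)
  qed
  have fin: "finite (range f)" using simple_functionD(1)[OF assms] by simp
  have "f = (\<lambda>z. \<Sum>y\<in>range f. y * indicator (f -` {y}) z)"
  proof
    fix z
    have "(\<Sum>y\<in>range f. y * indicator (f -` {y}) z) = (\<Sum>y\<in>range f. if y = f z then f z else 0)"
      by (rule sum.cong) (auto simp: indicator_def)
    then show "f z = (\<Sum>y\<in>range f. y * indicator (f -` {y}) z)"
      using fin by simp
  qed
  with sum[OF fin] show "square_integrable circle f" "l2_of f \<in> X" by simp_all
qed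

lemma l2_circle_dense: "x \<in> X"
proof -
  obtain F where F: "\<And>i. simple_function circle (F i)" "\<And>z. (\<lambda>i. F i z) \<longlonglongrightarrow> l2_fun x z"
    "\<And>i z. cmod (F i z) \<le> 2 * cmod (l2_fun x z)"
    using borel_measurable_implies_sequence_metric[of "l2_fun x" circle 0] by auto
  have [measurable]: "F i \<in> borel_measurable borel" for i
    using borel_measurable_simple_function[OF F(1)] by simp
  have "(\<lambda>i. \<integral>z. (cmod (F i z - l2_fun x z))\<^sup>2 \<partial>circle) \<longlonglongrightarrow> (\<integral>z. 0 \<partial>circle)"
  proof (rule integral_dominated_convergence)
    \<comment> \<open>The constant is the square of 3 in \<open>|F i - x| \<le> 3 |x|\<close>, which
      follows from \<open>|F i| \<le> 2 |x|\<close>.\<close>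
    show "integrable circle (\<lambda>z. 9 * (cmod (l2_fun x z))\<^sup>2)"
      using square_integrable_l2_fun[of x] by (simp add: square_integrable_def)
    show "AE z in circle. (\<lambda>i. (cmod (F i z - l2_fun x z))\<^sup>2) \<longlonglongrightarrow> 0"
      using F(2) by (intro AE_I2) (auto intro!: tendsto_eq_intros)
    fix i
    have "cmod (F i z - l2_fun x z) \<le> 3 * cmod (l2_fun x z)" for z
      using norm_triangle_ineq4[of "F i z" "l2_fun x z"] F(3)[of i z] by linarith
    then have "(cmod (F i z - l2_fun x z))\<^sup>2 \<le> (3 * cmod (l2_fun x z))\<^sup>2" for z
      by (intro power_mono) auto
    then show "AE z in circle. norm ((cmod (F i z - l2_fun x z))\<^sup>2) \<le> 9 * (cmod (l2_fun x z))\<^sup>2"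
      by (simp add: power_mult_distrib)
  qed simp_all
  also have "(\<lambda>i. \<integral>z. (cmod (F i z - l2_fun x z))\<^sup>2 \<partial>circle) = (\<lambda>i. (norm (l2_of (F i) - x))\<^sup>2)"
    using norm_l2_of_diff[OF simple_in_subspace(1)[OF F(1)] square_integrable_l2_fun] by simp
  finally have "(\<lambda>i. sqrt ((norm (l2_of (F i) - x))\<^sup>2)) \<longlonglongrightarrow> sqrt 0"
    by (intro tendsto_real_sqrt) simp
  then have "(\<lambda>i. l2_of (F i)) \<longlonglongrightarrow> x"
    by (simp add: tendsto_norm_zero_iff LIM_zero_iff)
  then show ?thesis
    by (rule closed_sequentially[OF closed_csubspaceD(1)[OF X] simple_in_subspace(2)[OF F(1)]])
qed

end


section \<open>Hankel operators\<close>

abbreviation hardy_one :: hardy where "hardy_one \<equiv> hardy_poly [:1:]"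

lemma l2_poly_0: "l2_poly 0 = 0"
proof -
  have "poly 0 = (\<lambda>_. 0 :: complex)" by (simp add: fun_eq_iff)
  then show ?thesis by (simp add: l2_poly.abs_eq zero_l2_circle.abs_eq)
qed

lemma bounded_clinear_isometry:
  assumes "\<And>x y. A (x + y) = A x + A y" "\<And>c x. A (c *\<^sub>C x) = c *\<^sub>C A x"
    and "\<And>x. cinner (A x) (A x) = cinner x x"
  shows "bounded_clinear A"
  unfolding bounded_clinear_def
proof (intro conjI allI assms bounded_linear_intro)
  show "A (r *\<^sub>R x) = r *\<^sub>R A x" for r x by (simp add: scaleR_scaleC assms)
  show "norm (A x) \<le> norm x * 1" for x
    using assms(3)[of x] by (simp add: cinner_self power2_eq_iff_nonneg del: of_real_power)
qed

lemma l2_mult_z_linear: "l2_mult_z (f + g) = l2_mult_z f + l2_mult_z g" "l2_mult_z (c *\<^sub>C f) = c *\<^sub>C l2_mult_z f"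
  by (rule cinner_ext; simp add: cinner_l2_mult_z cinner_add_left cinner_scaleC_left)+

lemma cinner_l2_mult_cnj_z: "cinner (l2_mult_cnj_z f) g = cinner f (l2_mult_z g)"
  by (metis cinner_l2_mult_z cinner_commute)

lemma l2_mult_cnj_z_linear:
  "l2_mult_cnj_z (f + g) = l2_mult_cnj_z f + l2_mult_cnj_z g" "l2_mult_cnj_z (c *\<^sub>C f) = c *\<^sub>C l2_mult_cnj_z f"
  by (rule cinner_ext; simp add: cinner_l2_mult_cnj_z cinner_add_left cinner_scaleC_left)+

lemma bounded_clinear_l2_mult_z: "bounded_clinear l2_mult_z" "bounded_clinear l2_mult_cnj_z"
  by (rule bounded_clinear_isometry;
      simp add: l2_mult_z_linear l2_mult_cnj_z_linear cinner_l2_mult_z cinner_l2_mult_cnj_z)+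

lemma fourier_coeff_mult_cnj_z: "fourier_coeff (l2_mult_cnj_z f) n = fourier_coeff f (n + 1)"
  using fourier_coeff_mult_z[of "l2_mult_cnj_z f" "n + 1"] by simp

lemma fourier_coeff_zero_hardy: "fourier_coeff (hardy_l2 f) n = 0" if "n < 0"
  using hardy_l2[of f] that by simp

lemma fourier_coeff_l2_monom_0: "fourier_coeff (l2_monom 0) 0 = 1"
proof -
  have "fourier_coeff (l2_monom 0) 0 = (\<integral>z. 1 \<partial>circle)"
    unfolding fourier_coeff_def by transfer simp
  also have "\<dots> = 1" using emeasure_circle by (simp add: measure_def)
  finally show ?thesis .
qed

section \<open>The shift and its adjoint\<close>

text \<open>The constant term is removed before the division by \<open>z\<close>; otherwise it would
  land at index -1.\<close>

lemma fourier_coeff_backward_shift: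
  assumes f: "\<forall>n<0. fourier_coeff f n = 0" and "n < 0"
  shows "fourier_coeff (l2_mult_cnj_z (f - fourier_coeff f 0 *\<^sub>C l2_monom 0)) n = 0"
proof -
  have "fourier_coeff f (n + 1) - fourier_coeff f 0 * fourier_coeff (l2_monom 0) (n + 1) = 0" if "n < 0" for n
  proof (cases "n = - 1")
    case True
    then show ?thesis by (simp add: fourier_coeff_l2_monom_0)
  next
    case False
    with that f show ?thesis by (simp add: fourier_coeff_one)
  qed
  from this[OF assms(2)] show ?thesis
    by (simp only: fourier_coeff_mult_cnj_z)
      (simp add: fourier_coeff_def cinner_diff_left cinner_scaleC_left)
qed

text \<open>An explicit candidate for the adjoint of the shift, namely
  \<open>(f - f(0)) / z\<close>. As \<open>adjoint\<close> is defined by choice, it can be computed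
  only after an operator with the adjoint property has been exhibited.\<close>

lift_definition backward_shift :: "hardy \<Rightarrow> hardy" is
  "\<lambda>f. l2_mult_cnj_z (f - fourier_coeff f 0 *\<^sub>C l2_monom 0)"
  by (auto intro: fourier_coeff_backward_shift)

lemma hardy_l2_one: "hardy_l2 hardy_one = l2_monom 0"
  using l2_poly_pCons[of 1 0] bounded_clinearD(5)[OF bounded_clinear_l2_mult_z(1)]
  by (simp add: hardy_poly.rep_eq l2_poly_0 scaleC_one)

lemma fourier_coeff_0_hardy: "fourier_coeff (hardy_l2 f) 0 = cinner f hardy_one"
  by (simp add: fourier_coeff_def cinner_hardy.rep_eq hardy_l2_one)

lemma hardy_l2_simps:
  "hardy_l2 (f + g) = hardy_l2 f + hardy_l2 g" "hardy_l2 (f - g) = hardy_l2 f - hardy_l2 g"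
  "hardy_l2 (c *\<^sub>C f) = c *\<^sub>C hardy_l2 f" "hardy_l2 (shift f) = l2_mult_z (hardy_l2 f)"
  "hardy_l2 0 = 0"
  by (simp_all add: plus_hardy.rep_eq minus_hardy.rep_eq scaleC_hardy.rep_eq shift.rep_eq zero_hardy.rep_eq)

lemma cinner_shift_one: "cinner (shift f) hardy_one = 0"
  by (simp add: fourier_coeff_zero_hardy hardy_l2_simps fourier_coeff_mult_z flip: fourier_coeff_0_hardy)

lemma shift_backward_shift: "shift (backward_shift f) = f - cinner f hardy_one *\<^sub>C hardy_one"
proof -
  have "hardy_l2 (shift (backward_shift f)) = hardy_l2 (f - cinner f hardy_one *\<^sub>C hardy_one)"
    by (simp add: hardy_l2_simps backward_shift.rep_eq hardy_l2_one flip: fourier_coeff_0_hardy)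
  then show ?thesis by (simp only: hardy_l2_inject)
qed

text \<open>The shift preserves inner products, and its range is orthogonal to the constants, so the
  constant dropped by \<open>backward_shift\<close> does not contribute.\<close>

lemma cinner_shift: "cinner (shift f) g = cinner f (backward_shift g)"
proof -
  have "cinner f (backward_shift g) = cinner (shift f) (shift (backward_shift g))"
    by (simp add: cinner_hardy.rep_eq hardy_l2_simps cinner_l2_mult_z)
  also have "\<dots> = cinner (shift f) g"
    by (simp add: shift_backward_shift cinner_diff_right cinner_scaleC_right cinner_shift_one)
  finally show ?thesis ..
qed

lemma cinner_backward_shift: "cinner (backward_shift f) g = cinner f (shift g)"
  by (metis cinner_shift cinner_commute)

lemma bounded_clinear_shift: "bounded_clinear shift"
proof (rule bounded_clinear_isometry)
  show "shift (x + y) = shift x + shift y" "shift (c *\<^sub>C x) = c *\<^sub>C shift x" for c x y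
    by (rule cinner_ext; simp add: cinner_shift cinner_add_left cinner_scaleC_left)+
  show "cinner (shift x) (shift x) = cinner x x" for x
    by (simp add: cinner_hardy.rep_eq hardy_l2_simps cinner_l2_mult_z)
qed

lemma norm_shift: "norm (shift x) = norm x"
proof -
  have "cinner (shift x) (shift x) = cinner x x"
    by (simp add: cinner_hardy.rep_eq hardy_l2_simps cinner_l2_mult_z)
  then show ?thesis by (simp add: cinner_self power2_eq_iff_nonneg del: of_real_power)
qed

lemma bounded_clinear_backward_shift: "bounded_clinear backward_shift"
proof -
  have lin: "backward_shift (x + y) = backward_shift x + backward_shift y"
    "backward_shift (c *\<^sub>C x) = c *\<^sub>C backward_shift x" for c x y
    by (rule cinner_ext; simp add: cinner_backward_shift cinner_add_left cinner_scaleC_left)+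
  have "norm (backward_shift x) \<le> norm x * 1" for x
  proof -
    have "(norm (backward_shift x))\<^sup>2 = inner (shift (backward_shift x)) x"
      by (simp add: power2_norm_eq_inner inner_eq_Re_cinner cinner_shift)
    also have "\<dots> \<le> norm (backward_shift x) * norm x"
      using norm_cauchy_schwarz[of "shift (backward_shift x)" x] by (simp add: norm_shift)
    finally show ?thesis
      by (cases "norm (backward_shift x) = 0") (simp_all add: power2_eq_square)
  qed
  then show ?thesis
    unfolding bounded_clinear_def
    by (intro conjI allI lin bounded_linear_intro[of backward_shift 1]) (simp_all add: lin scaleR_scaleC)
qed

lemma adjoint_shift: "adjoint shift = backward_shift"
  by (rule adjoint_unique) (simp add: inner_eq_Re_cinner cinner_shift)

lemma hardy_poly_pCons: "hardy_poly (pCons a p) = a *\<^sub>C hardy_one + shift (hardy_poly p)"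
proof -
  have "hardy_l2 (hardy_poly (pCons a p)) = hardy_l2 (a *\<^sub>C hardy_one + shift (hardy_poly p))"
    by (simp only: hardy_l2_simps hardy_l2_one) (simp add: hardy_poly.rep_eq l2_poly_pCons)
  then show ?thesis by (simp only: hardy_l2_inject)
qed

lemma hardy_poly_0: "hardy_poly 0 = 0"
  using l2_poly_0 by (simp add: hardy_l2_inject[symmetric] hardy_poly.rep_eq hardy_l2_simps)

lemma hardy_poly_monom: "hardy_poly (monom 1 n) = (shift ^^ n) hardy_one"
  by (induction n) (simp_all add: monom_0 monom_Suc hardy_poly_pCons[of 0])

text \<open>Trigonometric polynomials split into a polynomial and a part orthogonal to the Hardy space.\<close>

lemma hardy_poly_dense: "f \<in> closure (range hardy_poly)"
proof -
  \<comment> \<open>The orthogonal complement of the Hardy space.\<close>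
  define N where "N = {w. \<forall>g. cinner w (hardy_l2 g) = 0}"
  have N: "0 \<in> N" "v \<in> N \<Longrightarrow> w \<in> N \<Longrightarrow> v + w \<in> N" "w \<in> N \<Longrightarrow> c *\<^sub>C w \<in> N" for c v w
    by (simp_all add: N_def cinner_add_left cinner_scaleC_left)
  define Y where "Y = {hardy_l2 (hardy_poly p) + w | p w. w \<in> N}"
  note shift = bounded_clinearD[OF bounded_clinear_shift]
  have add: "hardy_poly (p + q) = hardy_poly p + hardy_poly q" for p q
  proof (induction p arbitrary: q)
    case (pCons a p)
    obtain b r where q: "q = pCons b r" by (cases q)
    have "hardy_poly (pCons a p + q)
        = (a *\<^sub>C hardy_one + shift (hardy_poly p)) + (b *\<^sub>C hardy_one + shift (hardy_poly r))"
      by (simp only: q add_pCons hardy_poly_pCons[of "a + b"] pCons.IH shift scaleC_add_left ac_simps)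
    then show ?case by (simp only: q hardy_poly_pCons[of a p] hardy_poly_pCons[of b r])
  qed (simp add: hardy_poly_0)
  have smult: "hardy_poly (smult c p) = c *\<^sub>C hardy_poly p" for c p
  proof (induction p)
    case (pCons a p)
    show ?case
      by (simp only: smult_pCons hardy_poly_pCons[of "c * a"] hardy_poly_pCons[of a p] pCons.IH shift
          scaleC_add_right scaleC_scaleC)
  qed (simp add: hardy_poly_0)
  have cs: "closed_csubspace (closure Y)"
  proof (rule closed_csubspace_closure)
    have "0 = hardy_l2 (hardy_poly 0) + 0" by (simp add: hardy_poly_0 hardy_l2_simps)
    then show "0 \<in> Y" using N(1) unfolding Y_def by blast
  next
    fix x y assume "x \<in> Y" "y \<in> Y"
    then obtain p v q w where "x = hardy_l2 (hardy_poly p) + v" "v \<in> N" "y = hardy_l2 (hardy_poly q) + w" "w \<in> N"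
      unfolding Y_def by blast
    then have "x + y = hardy_l2 (hardy_poly (p + q)) + (v + w)" "v + w \<in> N"
      by (simp_all add: add hardy_l2_simps N)
    then show "x + y \<in> Y" unfolding Y_def by blast
  next
    fix c x assume "x \<in> Y"
    then obtain p v where "x = hardy_l2 (hardy_poly p) + v" "v \<in> N"
      unfolding Y_def by blast
    then have "c *\<^sub>C x = hardy_l2 (hardy_poly (smult c p)) + c *\<^sub>C v" "c *\<^sub>C v \<in> N"
      by (simp_all add: smult hardy_l2_simps N scaleC_add_right)
    then show "c *\<^sub>C x \<in> Y" unfolding Y_def by blast
  qed
  have z: "l2_mult_z x \<in> Y" if "x \<in> Y" for x
  proof -
    obtain p w where x: "x = hardy_l2 (hardy_poly p) + w" "w \<in> N"
      using \<open>x \<in> Y\<close> unfolding Y_def by blast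
    \<comment> \<open>Multiplication by \<open>z\<close> can carry only the component of
      \<open>w\<close> at index -1 out of \<open>N\<close>. It becomes the constant
      \<open>c\<close>, which is moved to the polynomial part.\<close>
    define c where "c = cinner (l2_mult_z w) (l2_monom 0)"
    have "cinner (l2_mult_z w - c *\<^sub>C l2_monom 0) (hardy_l2 g) = 0" for g
    proof -
      have g: "g = shift (backward_shift g) + cinner g hardy_one *\<^sub>C hardy_one"
        by (simp add: shift_backward_shift)
      have "cinner (l2_mult_z w) (hardy_l2 g) = cnj (cinner g hardy_one) * c"
        using x(2) by (subst g) (simp add: N_def hardy_l2_simps cinner_add_right cinner_scaleC_right
            hardy_l2_one c_def cinner_l2_mult_z)
      moreover have "cinner (l2_monom 0) (hardy_l2 g) = cnj (cinner g hardy_one)"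
        by (subst cinner_commute) (simp add: cinner_hardy.rep_eq hardy_l2_one)
      ultimately show ?thesis by (simp add: cinner_diff_left cinner_scaleC_left)
    qed
    then have "l2_mult_z w - c *\<^sub>C l2_monom 0 \<in> N" by (simp add: N_def)
    moreover have "l2_mult_z x = hardy_l2 (hardy_poly (pCons c p)) + (l2_mult_z w - c *\<^sub>C l2_monom 0)"
      by (simp add: x l2_mult_z_linear hardy_poly_pCons[of c p] hardy_l2_simps hardy_l2_one)
    ultimately show ?thesis unfolding Y_def by blast
  qed
  have cnj_z: "l2_mult_cnj_z x \<in> Y" if "x \<in> Y" for x
  proof -
    obtain p w where x: "x = hardy_l2 (hardy_poly p) + w" "w \<in> N"
      using \<open>x \<in> Y\<close> unfolding Y_def by blast
    obtain a q where p: "p = pCons a q" by (cases p)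
    \<comment> \<open>Division by \<open>z\<close> sends the constant coefficient of the polynomial
      part to index -1, hence into \<open>N\<close>.\<close>
    have "cinner (l2_mult_cnj_z (l2_monom 0)) (hardy_l2 g) = 0" for g
    proof -
      have "cinner (l2_mult_cnj_z (l2_monom 0)) (hardy_l2 g) = cinner hardy_one (shift g)"
        by (simp add: cinner_l2_mult_cnj_z cinner_hardy.rep_eq hardy_l2_simps hardy_l2_one)
      also have "\<dots> = 0"
        by (subst cinner_commute) (simp add: cinner_shift_one)
      finally show ?thesis .
    qed
    then have "l2_mult_cnj_z (l2_monom 0) \<in> N" by (simp add: N_def)
    moreover have "l2_mult_cnj_z w \<in> N"
      using x(2) by (simp add: N_def cinner_l2_mult_cnj_z flip: hardy_l2_simps)
    ultimately have "a *\<^sub>C l2_mult_cnj_z (l2_monom 0) + l2_mult_cnj_z w \<in> N"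
      by (intro N)
    moreover have "l2_mult_cnj_z x = hardy_l2 (hardy_poly q) + (a *\<^sub>C l2_mult_cnj_z (l2_monom 0) + l2_mult_cnj_z w)"
      by (simp add: x p hardy_poly_pCons[of a q] hardy_l2_simps l2_mult_cnj_z_linear hardy_l2_one)
    ultimately show ?thesis unfolding Y_def by blast
  qed
  have "hardy_l2 f \<in> closure Y"
  proof (rule l2_circle_dense[OF cs])
    have "l2_monom 0 = hardy_l2 hardy_one + 0" by (simp add: hardy_l2_one)
    then have "l2_monom 0 \<in> Y" unfolding Y_def using N(1) by blast
    then show "l2_monom 0 \<in> closure Y" by (rule subsetD[OF closure_subset])
    have "l2_mult_z ` closure Y \<subseteq> closure (l2_mult_z ` Y)" "l2_mult_cnj_z ` closure Y \<subseteq> closure (l2_mult_cnj_z ` Y)"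
      by (intro closure_bounded_linear_image_subset bounded_clinearD(1) bounded_clinear_l2_mult_z)+
    moreover have "closure (l2_mult_z ` Y) \<subseteq> closure Y" "closure (l2_mult_cnj_z ` Y) \<subseteq> closure Y"
      using z cnj_z by (intro closure_mono; blast)+
    ultimately show "l2_mult_z x \<in> closure Y" "l2_mult_cnj_z x \<in> closure Y" if "x \<in> closure Y" for x
      using that by blast+
  qed
  show ?thesis
    unfolding closure_approachable
  proof (intro allI impI)
    fix e :: real assume "e > 0"
    with \<open>hardy_l2 f \<in> closure Y\<close> obtain y where y: "y \<in> Y" "dist y (hardy_l2 f) < e"
      unfolding closure_approachable by blast
    then obtain p w where pw: "y = hardy_l2 (hardy_poly p) + w" "w \<in> N"
      unfolding Y_def by blast
    let ?d = "f - hardy_poly p"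
    \<comment> \<open>By Pythagoras, dropping the orthogonal part \<open>w\<close> does not increase
      the distance to \<open>f\<close>, so the polynomial alone is a good approximation.\<close>
    have "inner w (hardy_l2 ?d) = 0"
      using pw(2) by (simp add: N_def inner_eq_Re_cinner)
    then have "(norm (w - hardy_l2 ?d))\<^sup>2 = (norm w)\<^sup>2 + (norm (hardy_l2 ?d))\<^sup>2"
      by (simp add: power2_norm_eq_inner inner_diff_left inner_diff_right inner_commute)
    then have "(norm (hardy_l2 ?d))\<^sup>2 \<le> (norm (w - hardy_l2 ?d))\<^sup>2"
      by simp
    then have "norm (hardy_l2 ?d) \<le> norm (w - hardy_l2 ?d)"
      by (rule power2_le_imp_le) simp
    also have "w - hardy_l2 ?d = y - hardy_l2 f"
      by (simp add: pw hardy_l2_simps)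
    finally have "dist (hardy_poly p) f < e"
      using y(2) unfolding dist_norm norm_hardy.rep_eq[symmetric] by (simp add: norm_minus_commute)
    then show "\<exists>y\<in>range hardy_poly. dist y f < e" by blast
  qed
qed

lemma hardy_dense:
  assumes X: "closed_csubspace X" and "\<And>n. (shift ^^ n) hardy_one \<in> X"
  shows "f \<in> X"
proof -
  \<comment> \<open>All powers of the shift are treated together, because \<open>pCons\<close>
    trades one degree for one more shift.\<close>
  have "(shift ^^ n) (hardy_poly p) \<in> X" for n p
  proof (induction p arbitrary: n)
    case 0
    have "(shift ^^ n) 0 = 0" by (induction n) (simp_all add: bounded_clinearD[OF bounded_clinear_shift])
    then show ?case using closed_csubspaceD(2)[OF X] by (simp add: hardy_poly_0)
  next
    case (pCons a p)
    have lin: "(shift ^^ n) (x + y) = (shift ^^ n) x + (shift ^^ n) y"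
      "(shift ^^ n) (c *\<^sub>C x) = c *\<^sub>C (shift ^^ n) x" for c x y
      by (induction n) (simp_all add: bounded_clinearD[OF bounded_clinear_shift])
    have "(shift ^^ n) (hardy_poly (pCons a p)) = a *\<^sub>C (shift ^^ n) hardy_one + (shift ^^ Suc n) (hardy_poly p)"
      unfolding hardy_poly_pCons[of a p] lin by (simp add: funpow_swap1)
    also have "\<dots> \<in> X"
      by (intro closed_csubspaceD(3,4)[OF X] assms pCons)
    finally show ?case .
  qed
  from this[of 0] have "range hardy_poly \<subseteq> X" by auto
  then have "closure (range hardy_poly) \<subseteq> X"
    using closed_csubspaceD(1)[OF X] by (rule closure_minimal)
  with hardy_poly_dense show ?thesis by blast
qed

lemma cinner_funpow_shift: "cinner ((shift ^^ n) f) g = cinner f ((backward_shift ^^ n) g)"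
  by (induction n arbitrary: f g) (simp_all add: cinner_shift funpow_swap1)

text \<open>The numbers compared are the Fourier coefficients: moving the backward shifts across
  gives the inner product of the function with \<open>(shift ^^ n) hardy_one\<close>.\<close>

lemma hardy_eqI:
  assumes "\<And>n. cinner ((backward_shift ^^ n) f) hardy_one = cinner ((backward_shift ^^ n) g) hardy_one"
  shows "f = g"
proof (rule cinner_ext)
  fix h
  have "h \<in> {h. cinner h f = cinner h g}"
  proof (rule hardy_dense)
    show "closed_csubspace {h. cinner h f = cinner h g}"
      unfolding closed_csubspace_def
      by (auto simp: cinner_add_left cinner_scaleC_left intro!: closed_Collect_eq continuous_intros)
    fix n
    show "(shift ^^ n) hardy_one \<in> {h. cinner h f = cinner h g}"
      using arg_cong[OF assms[of n], of cnj] by (simp add: cinner_funpow_shift flip: cinner_commute)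
  qed
  then show "cinner f h = cinner g h" by (simp add: cinner_commute[of _ h])
qed

section \<open>The projection and Hankel operators\<close>

text \<open>\<open>hardy_proj\<close> is a definite description; each use provides its value
  \<open>h\<close> explicitly, which settles existence.\<close>

lemma hardy_projI:
  assumes "\<And>g. cinner f (hardy_l2 g) = cinner h g" shows "hardy_proj f = h"
  unfolding hardy_proj_def
proof (rule the_equality)
  show "\<forall>g. cinner (f - hardy_l2 h) (hardy_l2 g) = 0"
    using assms by (simp add: cinner_diff_left cinner_hardy.rep_eq)
  fix h' assume h': "\<forall>g. cinner (f - hardy_l2 h') (hardy_l2 g) = 0"
  show "h' = h"
  proof (rule cinner_ext)
    fix g show "cinner h' g = cinner h g"
      using h'[rule_format, of g] assms[of g] by (simp add: cinner_diff_left cinner_hardy.rep_eq)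
  qed
qed

lemma cinner_l2_mult_cnj_monom:
  "cinner (l2_mult_cnj_poly f (monom 1 n)) (hardy_l2 g) = cinner f (hardy_l2 ((shift ^^ n) g))"
proof (induction n arbitrary: g)
  case 0
  have "cinner (l2_mult_cnj_poly f (monom 1 0)) h = cinner f h" for h
    by transfer (simp add: monom_0)
  then show ?case by simp
next
  case (Suc n)
  have "cinner (l2_mult_cnj_poly f (pCons 0 p)) h = cinner (l2_mult_cnj_poly f p) (l2_mult_z h)" for p h
    by transfer (simp add: mult_ac)
  from this[of "monom 1 n" "hardy_l2 g"] show ?case
    by (simp add: monom_Suc Suc funpow_swap1 flip: hardy_l2_simps)
qed

context
  fixes u H assumes hankel: "is_hankel u H"
begin

lemma hankel_antilinear: "bounded_antilinear H"
  using hankel by (simp add: is_hankel_def)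

lemmas hankel_simps = bounded_antilinearD[OF hankel_antilinear]
lemmas continuous_on_hankel = bounded_linear.continuous_on[OF hankel_simps(1)]

text \<open>Multiplying by the conjugate of \<open>z^n\<close> and projecting is the adjoint of the
  \<open>n\<close>-th power of the shift. This fixes \<open>H\<close> on monomials, from which the
  further identities are extended by density.\<close>

lemma hankel_funpow_shift_one: "H ((shift ^^ n) hardy_one) = (backward_shift ^^ n) u"
proof -
  have "hardy_proj (l2_mult_cnj_poly (hardy_l2 u) (monom 1 n)) = (backward_shift ^^ n) u"
  proof (rule hardy_projI)
    fix g
    have "cinner u ((shift ^^ n) g) = cinner ((backward_shift ^^ n) u) g"
      by (subst (1 2) cinner_commute) (simp add: cinner_funpow_shift)
    then show "cinner (l2_mult_cnj_poly (hardy_l2 u) (monom 1 n)) (hardy_l2 g) = cinner ((backward_shift ^^ n) u) g"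
      by (simp add: cinner_l2_mult_cnj_monom cinner_hardy.rep_eq)
  qed
  with hankel show ?thesis by (simp add: is_hankel_def flip: hardy_poly_monom)
qed

lemma hankel_one: "H hardy_one = u"
  using hankel_funpow_shift_one[of 0] by simp

lemma hankel_shift: "H (shift f) = backward_shift (H f)"
proof -
  note S = bounded_clinearD[OF bounded_clinear_shift] and S' = bounded_clinearD[OF bounded_clinear_backward_shift]
  have "f \<in> {f. H (shift f) = backward_shift (H f)}"
  proof (rule hardy_dense)
    show "closed_csubspace {f. H (shift f) = backward_shift (H f)}"
      unfolding closed_csubspace_def
      by (auto simp: hankel_simps S S' intro!: closed_Collect_eq continuous_on_hankel continuous_on_id
          bounded_linear.continuous_on[OF S(1)] bounded_linear.continuous_on[OF S'(1)])
    show "(shift ^^ n) hardy_one \<in> {f. H (shift f) = backward_shift (H f)}" for n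
      using hankel_funpow_shift_one[of n] hankel_funpow_shift_one[of "Suc n"] by simp
  qed
  then show ?thesis by simp
qed

text \<open>On monomials both sides are the Fourier coefficient of \<open>u\<close> at
  \<open>n + m\<close>. Both sides are antilinear in \<open>f\<close>, and also in \<open>g\<close>,
  so density extends the identity to one argument at a time.\<close>

lemma hankel_symmetric: "cinner (H f) g = cinner (H g) f"
proof -
  have cs: "closed_csubspace {f. cinner (H f) g = cinner (H g) f}" for g
    unfolding closed_csubspace_def
    by (auto simp: hankel_simps cinner_add_left cinner_add_right cinner_scaleC_left cinner_scaleC_right
        intro!: closed_Collect_eq continuous_intros continuous_on_hankel)
  have *: "f \<in> {f. cinner (H f) ((shift ^^ m) hardy_one) = cinner (H ((shift ^^ m) hardy_one)) f}" for m f
  proof (rule hardy_dense[OF cs])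
    fix n
    have "cinner ((backward_shift ^^ n) u) ((shift ^^ m) hardy_one) = cinner u ((shift ^^ (n + m)) hardy_one)" for n m
      by (subst (1 2) cinner_commute) (simp add: cinner_funpow_shift funpow_add flip: cinner_funpow_shift)
    from this[of n m] this[of m n]
    show "(shift ^^ n) hardy_one \<in> {f. cinner (H f) ((shift ^^ m) hardy_one) = cinner (H ((shift ^^ m) hardy_one)) f}"
      by (simp add: hankel_funpow_shift_one add.commute)
  qed
  have "f \<in> {f. cinner (H f) g = cinner (H g) f}"
    by (rule hardy_dense[OF cs]) (use * in auto)
  then show ?thesis by simp
qed

lemma hankel_tilde_eq: "hankel_tilde H f = backward_shift (H f)"
  by (simp add: hankel_tilde_def adjoint_shift)

text \<open>The commutation \<open>hankel_shift\<close> brings \<open>shift\<close> and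
  \<open>backward_shift\<close> together between two factors \<open>H\<close>. Their product is the
  identity minus the projection onto constants, and the latter yields the rank-one term because
  \<open>H\<close> sends 1 to \<open>u\<close>.\<close>

lemma hankel_tilde_square:
  "hankel_tilde H (hankel_tilde H f) = H (H f) - cinner f u *\<^sub>C u"
proof -
  have "hankel_tilde H (hankel_tilde H f) = H (shift (backward_shift (H f)))"
    by (simp add: hankel_tilde_eq hankel_shift)
  also have "\<dots> = H (H f) - cnj (cinner (H f) hardy_one) *\<^sub>C u"
    by (simp add: shift_backward_shift hankel_simps hankel_one)
  also have "cnj (cinner (H f) hardy_one) = cinner f u"
    unfolding hankel_symmetric[of f] hankel_one by (rule cinner_commute[symmetric])
  finally show ?thesis .
qed

end


section \<open>Uniqueness of the symbol\<close>

lemma funpow_eq_poly_op: "(F ^^ k) x = poly_op F (monom 1 k) x"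
proof -
  have "coeff (monom 1 k) i *\<^sub>C (F ^^ i) x = (if i = k then (F ^^ i) x else 0)" for i
    by (simp add: scaleC_one)
  then show ?thesis
    by (simp add: poly_op_def degree_monom_eq del: coeff_monom)
qed

text \<open>This makes \<open>u\<close> a limit of vectors in the range of \<open>H\<close>: the
  difference of \<open>u\<close> and its \<open>n\<close>-th iterate is a sum of vectors
  \<open>c *\<^sub>R H (H x)\<close>.\<close>

lemma hankel_iterates_tendsto_zero:
  assumes "is_hankel u H"
  obtains c :: real where "(\<lambda>n. ((\<lambda>x. x - c *\<^sub>R H (H x)) ^^ n) u) \<longlonglongrightarrow> 0"
proof -
  note H = hankel_simps[OF assms]
  \<comment> \<open>Small enough that \<open>c\<close> times the squared norm of \<open>H\<close> is
    at most 1; the summand 1 covers \<open>H = 0\<close>.\<close>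
  define c where "c = 1 / (1 + (onorm H)\<^sup>2)"
  define B where "B x = x - c *\<^sub>R H (H x)" for x
  have c: "c > 0" and cM: "c * (onorm H)\<^sup>2 \<le> 1"
    by (simp_all add: c_def add_pos_nonneg)
  have step: "c * (norm (H x))\<^sup>2 \<le> (norm x)\<^sup>2 - (norm (B x))\<^sup>2" for x
  proof -
    have "inner x (H (H x)) = inner (H x) (H x)"
      using hankel_symmetric[OF assms, of "H x" x] by (subst inner_commute) (simp add: inner_eq_Re_cinner)
    then have "(norm (B x))\<^sup>2 = (norm x)\<^sup>2 - 2 * c * (norm (H x))\<^sup>2 + c\<^sup>2 * (norm (H (H x)))\<^sup>2"
      unfolding B_def power2_norm_eq_inner
      by (simp add: inner_diff_left inner_diff_right inner_commute[of "H (H x)" x] power2_eq_square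
          algebra_simps)
    also have "c\<^sup>2 * (norm (H (H x)))\<^sup>2 \<le> c\<^sup>2 * (onorm H * norm (H x))\<^sup>2"
      by (intro mult_left_mono power_mono onorm[OF H(1)]) simp_all
    also have "\<dots> = c * (norm (H x))\<^sup>2 * (c * (onorm H)\<^sup>2)"
      by (simp add: power_mult_distrib power2_eq_square)
    also have "\<dots> \<le> c * (norm (H x))\<^sup>2"
      using mult_left_mono[OF cM, of "c * (norm (H x))\<^sup>2"] c by simp
    finally show ?thesis by simp
  qed
  \<comment> \<open>The iteration starts at the constant 1, one application of \<open>H\<close>
    before \<open>u\<close>. The decrease of the norms in \<open>step\<close> telescopes, so the
    squared norms of \<open>H (?x k)\<close> are summable.\<close>
  let ?x = "\<lambda>n. (B ^^ n) hardy_one"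
  have bound: "c * (\<Sum>k<n. (norm (H (?x k)))\<^sup>2) \<le> (norm hardy_one)\<^sup>2 - (norm (?x n))\<^sup>2" for n
  proof (induction n)
    case (Suc n)
    then show ?case using step[of "?x n"] by (simp add: distrib_left)
  qed simp
  have "c * (\<Sum>k<n. (norm (H (?x k)))\<^sup>2) \<le> (norm hardy_one)\<^sup>2" for n
    using bound[of n] zero_le_power2[of "norm (?x n)"] by linarith
  then have "(\<Sum>k<n. (norm (H (?x k)))\<^sup>2) \<le> (norm hardy_one)\<^sup>2 / c" for n
    using c by (simp add: field_simps)
  then have "summable (\<lambda>k. (norm (H (?x k)))\<^sup>2)"
    by (intro summableI_nonneg_bounded) auto
  then have "(\<lambda>k. sqrt ((norm (H (?x k)))\<^sup>2)) \<longlonglongrightarrow> sqrt 0"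
    by (intro tendsto_real_sqrt summable_LIMSEQ_zero)
  then have "(\<lambda>k. H (?x k)) \<longlonglongrightarrow> 0"
    by (simp add: tendsto_norm_zero_iff)
  \<comment> \<open>\<open>H\<close> commutes with \<open>B\<close> since \<open>c\<close> is
    real.\<close>
  moreover have "H (?x k) = (B ^^ k) u" for k
  proof (induction k)
    case (Suc k)
    have "H (B x) = B (H x)" for x
      by (simp add: B_def H linear_simps[OF H(1)])
    then show ?case using Suc by simp
  qed (simp add: hankel_one[OF assms])
  ultimately show ?thesis
    using that[of c] by (simp add: B_def[abs_def])
qed

section \<open>Comparison of two symbols with the same datum\<close>

text \<open>The constant 1 is square integrable because both measures are finite, and its calculus
  returns \<open>u\<close>. This instance of the two functional equations is all that is extracted
  from them.\<close>

lemma spectral_datum_one: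
  assumes "spectral_datum u \<rho> \<Psi> \<Psi>t"
  obtains H A At \<rho>t w wt where "is_hankel u H" "is_modulus H A" "is_modulus (hankel_tilde H) At"
    "is_spectral_measure A u \<rho>" "is_spectral_measure At u \<rho>t"
    "\<Psi> \<in> borel_measurable borel" "\<Psi>t \<in> borel_measurable borel"
    "is_L2_calculus A u \<rho> (\<lambda>s. cnj (\<Psi> s)) w" "H u = A w"
    "is_L2_calculus At u \<rho>t \<Psi>t wt" "hankel_tilde H u = At wt"
proof -
  obtain H A At \<rho>t where *: "is_hankel u H" "is_modulus H A" "is_modulus (hankel_tilde H) At"
    "is_spectral_measure A u \<rho>" "is_spectral_measure At u \<rho>t"
    "\<Psi> \<in> borel_measurable borel" "\<Psi>t \<in> borel_measurable borel"
    and 1: "\<forall>f. square_integrable \<rho> f \<longrightarrow> (\<exists>y w. is_L2_calculus A u \<rho> f y \<and>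
        is_L2_calculus A u \<rho> (\<lambda>s. cnj (\<Psi> s) * cnj (f s)) w \<and> H y = A w)"
    and 2: "\<forall>f. square_integrable \<rho>t f \<longrightarrow> (\<exists>y w. is_L2_calculus At u \<rho>t f y \<and>
        is_L2_calculus At u \<rho>t (\<lambda>s. \<Psi>t s * cnj (f s)) w \<and> hankel_tilde H y = At w)"
    using assms unfolding spectral_datum_def by (elim exE conjE) (rule that; assumption)
  have fin: "finite_measure \<rho>" "finite_measure \<rho>t" and psd: "psd A" "psd At"
    using * by (simp_all add: is_spectral_measure_def is_modulus_def)
  then have "square_integrable \<rho> (\<lambda>_. 1)" "square_integrable \<rho>t (\<lambda>_. 1)"
    by (simp_all add: square_integrable_def finite_measure.integrable_const)
  from 1[rule_format, OF this(1)] 2[rule_format, OF this(2)] obtain y w yt wt where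
    y: "is_L2_calculus A u \<rho> (\<lambda>_. 1) y" "is_L2_calculus A u \<rho> (\<lambda>s. cnj (\<Psi> s)) w" "H y = A w" and
    yt: "is_L2_calculus At u \<rho>t (\<lambda>_. 1) yt" "is_L2_calculus At u \<rho>t \<Psi>t wt" "hankel_tilde H yt = At wt"
    by auto
  have "y = u" "yt = u"
    using L2_calculus_one[OF psd(1) *(4) y(1)] L2_calculus_one[OF psd(2) *(5) yt(1)] by simp_all
  with y(3) yt(3) have "H u = A w" "hankel_tilde H u = At wt" by simp_all
  then show ?thesis by (intro that[OF * y(2) _ yt(2)])
qed

lemma bounded_antilinear_hankel_tilde:
  assumes "is_hankel u H" shows "bounded_antilinear (hankel_tilde H)"
proof -
  note S = bounded_clinearD[OF bounded_clinear_backward_shift] and H = hankel_simps[OF assms]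
  have "hankel_tilde H = (\<lambda>x. backward_shift (H x))"
    by (simp add: fun_eq_iff hankel_tilde_eq[OF assms])
  then show ?thesis
    using bounded_linear_compose[OF S(1) H(1)] by (simp add: bounded_antilinear_def S H)
qed

lemma modulus_square: "is_modulus H A \<Longrightarrow> A (A x) = H (H x)"
  by (metis is_modulus_def o_apply)

theorem spectral_datum_inject:
  assumes "spectral_datum u \<rho> \<Psi> \<Psi>t" and "spectral_datum v \<rho> \<Psi> \<Psi>t"
  shows "u = v"
proof -
  obtain H A At \<rho>t w wt where H: "is_hankel u H" "is_modulus H A" "is_modulus (hankel_tilde H) At"
    "is_spectral_measure A u \<rho>" "is_spectral_measure At u \<rho>t"
    and \<Psi>: "\<Psi> \<in> borel_measurable borel" "\<Psi>t \<in> borel_measurable borel"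
    and w: "is_L2_calculus A u \<rho> (\<lambda>s. cnj (\<Psi> s)) w" "H u = A w"
    and wt: "is_L2_calculus At u \<rho>t \<Psi>t wt" "hankel_tilde H u = At wt"
    using assms(1) by (rule spectral_datum_one)
  obtain H' A' At' \<rho>t' w' wt' where H': "is_hankel v H'" "is_modulus H' A'" "is_modulus (hankel_tilde H') At'"
    "is_spectral_measure A' v \<rho>" "is_spectral_measure At' v \<rho>t'"
    and w': "is_L2_calculus A' v \<rho> (\<lambda>s. cnj (\<Psi> s)) w'" "H' v = A' w'"
    and wt': "is_L2_calculus At' v \<rho>t' \<Psi>t wt'" "hankel_tilde H' v = At' wt'"
    using assms(2) by (rule spectral_datum_one)
  have A: "psd A" "psd A'" "psd At" "psd At'"
    using H H' by (simp_all add: is_modulus_def)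
  then have lin: "bounded_clinear A" "bounded_clinear A'" "bounded_clinear At" "bounded_clinear At'"
    by (simp_all add: psd_def)
  note sq = modulus_square[OF H(2)] modulus_square[OF H'(2)] modulus_square[OF H(3)] modulus_square[OF H'(3)]
  define V where "V = cyclic_pairs (A \<circ> A) (A' \<circ> A') u v"
  have V: "pair_subspace V" and uv: "(u, v) \<in> V" and VT: "maps_pairs V (A \<circ> A) (A' \<circ> A')"
    unfolding V_def by (rule cyclic_pairs_subspace cyclic_pairs_base cyclic_pairs_maps)+
  note VD = pair_subspaceD[OF V]
  have iso: "cinner x x' = cinner y y'" if "(x, y) \<in> V" "(x', y') \<in> V" for x x' y y'
  proof (rule cyclic_pairs_isometric[OF _ _ _ that[unfolded V_def]])
    show "cinner ((A \<circ> A) x) y = cinner x ((A \<circ> A) y)" "cinner ((A' \<circ> A') x) y = cinner x ((A' \<circ> A') y)" for x y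
      by (simp_all add: psd_symmetric A)
    \<comment> \<open>Both sides are the moment of order \<open>2 k\<close> of the common measure
      \<open>\<rho>\<close>.\<close>
    show "cinner (((A \<circ> A) ^^ k) u) u = cinner (((A' \<circ> A') ^^ k) v) v" for k
      unfolding funpow_eq_poly_op poly_op_square[OF lin(1), symmetric] poly_op_square[OF lin(2), symmetric]
        spectral_measure_poly[OF lin(1) H(4)] spectral_measure_poly[OF lin(2) H'(4)] ..
  qed
  have iso_u: "cinner x u = cinner y v" if "(x, y) \<in> V" for x y
    using iso[OF that uv] .

  have "(w, w') \<in> V"
    using \<Psi>(1) by (intro L2_calculus_pairs[OF V VT uv A(1,2) H(4) H'(4) _ w(1) w'(1)] borel_measurable_cnj')
  \<comment> \<open>\<open>V\<close> is generated by the squares only, but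
    \<open>s = sqrt (s^2)\<close> is a limit of even polynomials on the spectrum, which brings in
    \<open>A\<close> itself.\<close>
  moreover have "maps_pairs V A A'"
    using maps_pairs_cont_calculus[OF V VT lin(1,2) spectral_measure_identity(2)[OF lin(1) H(4)]
        spectral_measure_identity(2)[OF lin(2) H'(4)]] by (simp add: continuous_on_of_real)
  ultimately have Huv: "(H u, H' v) \<in> V"
    unfolding w w' by (rule maps_pairsD[rotated])
  \<comment> \<open>Minimality of \<open>V\<close>: the pairs whose images under \<open>H\<close>
    and \<open>H'\<close> stay in \<open>V\<close> form a closed subspace, which is invariant
    because \<open>H\<close> commutes with its own square.\<close>
  have "V \<subseteq> V \<inter> {(x, y). (H x, H' y) \<in> V}"
    unfolding V_def
  proof (rule cyclic_pairs_least, fold V_def)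
    show "pair_subspace (V \<inter> {(x, y). (H x, H' y) \<in> V})"
      by (intro pair_subspace_Int pair_subspace_vimage_antilinear V hankel_antilinear[OF H(1)] hankel_antilinear[OF H'(1)])
    show "(u, v) \<in> V \<inter> {(x, y). (H x, H' y) \<in> V}" using uv Huv by simp
    show "maps_pairs (V \<inter> {(x, y). (H x, H' y) \<in> V}) (A \<circ> A) (A' \<circ> A')"
      using VT by (auto simp: maps_pairs_def sq)
  qed
  then have VH: "(H x, H' y) \<in> V" if "(x, y) \<in> V" for x y
    using that by blast

  have tilde: "(At \<circ> At) x = (A \<circ> A) x - cinner x u *\<^sub>C u" "(At' \<circ> At') x = (A' \<circ> A') x - cinner x v *\<^sub>C v" for x
    by (simp_all add: sq hankel_tilde_square[OF H(1)] hankel_tilde_square[OF H'(1)])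
  \<comment> \<open>By \<open>iso_u\<close> the rank-one corrections have the same coefficient on
    both sides, so together they subtract a multiple of \<open>(u, v)\<close>.\<close>
  have VTt: "maps_pairs V (At \<circ> At) (At' \<circ> At')"
    unfolding maps_pairs_def tilde
    using maps_pairsD[OF VT] iso_u uv by (auto intro!: pair_subspace_diff[OF V] VD)
  \<comment> \<open>The second measure is not a component of the datum. It is recovered by pairing
    \<open>(f(At)u, f(At')v)\<close>, which lies in \<open>V\<close>, with
    \<open>(u, v)\<close>.\<close>
  have "\<rho>t = \<rho>t'"
  proof (rule finite_borel_measure_eqI)
    show "finite_measure \<rho>t" "finite_measure \<rho>t'" "sets \<rho>t = sets borel" "sets \<rho>t' = sets borel"
      using H H' by (simp_all add: is_spectral_measure_def)
    fix f :: "real \<Rightarrow> complex" assume f: "continuous_on UNIV f"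
    obtain B where B: "is_cont_calculus At f B" "has_bochner_integral \<rho>t f (cinner (B u) u)"
      using spectral_measure_calculus[OF H(5) f] by blast
    obtain B' where B': "is_cont_calculus At' f B'" "has_bochner_integral \<rho>t' f (cinner (B' v) v)"
      using spectral_measure_calculus[OF H'(5) f] by blast
    have "(B u, B' v) \<in> V"
      using maps_pairs_cont_calculus[OF V VTt lin(3,4) B(1) B'(1) f] uv by (rule maps_pairsD)
    from iso_u[OF this] show "(\<integral>s. f s \<partial>\<rho>t) = (\<integral>s. f s \<partial>\<rho>t')"
      using has_bochner_integral_integral_eq[OF B(2)] has_bochner_integral_integral_eq[OF B'(2)] by simp
  qed
  then have "(wt, wt') \<in> V"
    using H'(5) wt'(1) by (intro L2_calculus_pairs[OF V VTt uv A(3,4) H(5) _ \<Psi>(2) wt(1)]) simp_all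
  moreover have "maps_pairs V At At'"
    using maps_pairs_cont_calculus[OF V VTt lin(3,4) spectral_measure_identity(2)[OF lin(3) H(5)]
        spectral_measure_identity(2)[OF lin(4) H'(5)]] by (simp add: continuous_on_of_real)
  ultimately have Htuv: "(hankel_tilde H u, hankel_tilde H' v) \<in> V"
    unfolding wt wt' by (rule maps_pairsD[rotated])
  \<comment> \<open>\<open>hankel_tilde H\<close> commutes with its own square
    \<open>At \<circ> At\<close>, so the minimality argument needs \<open>V\<close> to be generated
    by that square. Adding the rank-one term back shows that the two generated spaces
    coincide.\<close>
  define Vt where "Vt = cyclic_pairs (At \<circ> At) (At' \<circ> At') u v"
  have Vt: "pair_subspace Vt" "(u, v) \<in> Vt" "maps_pairs Vt (At \<circ> At) (At' \<circ> At')"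
    unfolding Vt_def by (rule cyclic_pairs_subspace cyclic_pairs_base cyclic_pairs_maps)+
  have "Vt \<subseteq> V"
    unfolding Vt_def by (rule cyclic_pairs_least[OF V uv VTt])
  have "V \<subseteq> Vt"
    unfolding V_def
  proof (rule cyclic_pairs_least[OF Vt(1,2)])
    show "maps_pairs Vt (A \<circ> A) (A' \<circ> A')"
      unfolding maps_pairs_def
    proof (intro allI impI)
      fix x y assume xy: "(x, y) \<in> Vt"
      have "((At \<circ> At) x + cinner x u *\<^sub>C u, (At' \<circ> At') y + cinner x u *\<^sub>C v) \<in> Vt"
        by (intro pair_subspaceD[OF Vt(1)] maps_pairsD[OF Vt(3) xy] Vt(2))
      moreover have "cinner x u = cinner y v"
        using xy \<open>Vt \<subseteq> V\<close> by (intro iso_u) blast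
      ultimately show "((A \<circ> A) x, (A' \<circ> A') y) \<in> Vt"
        by (simp only: tilde) simp
    qed
  qed
  also have "Vt \<subseteq> V \<inter> {(x, y). (hankel_tilde H x, hankel_tilde H' y) \<in> V}"
    unfolding Vt_def
  proof (rule cyclic_pairs_least)
    show "pair_subspace (V \<inter> {(x, y). (hankel_tilde H x, hankel_tilde H' y) \<in> V})"
      by (intro pair_subspace_Int pair_subspace_vimage_antilinear V
          bounded_antilinear_hankel_tilde[OF H(1)] bounded_antilinear_hankel_tilde[OF H'(1)])
    show "(u, v) \<in> V \<inter> {(x, y). (hankel_tilde H x, hankel_tilde H' y) \<in> V}" using uv Htuv by simp
    show "maps_pairs (V \<inter> {(x, y). (hankel_tilde H x, hankel_tilde H' y) \<in> V}) (At \<circ> At) (At' \<circ> At')"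
      using VTt by (auto simp: maps_pairs_def sq)
  qed
  finally have VHt: "(backward_shift (H x), backward_shift (H' y)) \<in> V" if "(x, y) \<in> V" for x y
    using that by (auto simp: hankel_tilde_eq[OF H(1)] hankel_tilde_eq[OF H'(1)])

  \<comment> \<open>The two properties wanted for all pairs of \<open>V\<close>. They are first
    obtained for images under \<open>H\<close> and \<open>H'\<close>, then for \<open>(u, v)\<close>
    by a limit.\<close>
  define Q where "Q = {(x, y). (backward_shift x, backward_shift y) \<in> V} \<inter>
      {(x, y). cinner x hardy_one = cinner y hardy_one}"
  have Q: "pair_subspace Q"
    unfolding Q_def by (intro pair_subspace_Int pair_subspace_vimage bounded_clinear_backward_shift V
        pair_subspace_cinner_eq)
  have HQ: "(H x, H' y) \<in> Q" if "(x, y) \<in> V" for x y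
  proof -
    have "cinner (H x) hardy_one = cinner (H' y) hardy_one"
      unfolding hankel_symmetric[OF H(1), of x] hankel_symmetric[OF H'(1), of y]
        hankel_one[OF H(1)] hankel_one[OF H'(1)] by (rule iso[OF uv that])
    with VHt[OF that] show ?thesis by (simp add: Q_def)
  qed
  have uvQ: "(u, v) \<in> Q"
  proof -
    obtain c where c: "(\<lambda>n. ((\<lambda>x. x - c *\<^sub>R H (H x)) ^^ n) u) \<longlonglongrightarrow> 0"
      using hankel_iterates_tendsto_zero[OF H(1)] .
    define a where "a n = ((\<lambda>x. x - c *\<^sub>R H (H x)) ^^ n) u" for n
    define b where "b n = ((\<lambda>x. x - c *\<^sub>R H' (H' x)) ^^ n) v" for n
    have ab: "(a n, b n) \<in> V" for n
    proof (induction n)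
      case (Suc n)
      then show ?case
        by (simp add: a_def b_def scaleR_scaleC) (intro pair_subspace_diff[OF V] VD(4) VH)
    qed (simp add: a_def b_def uv)
    have "a \<longlonglongrightarrow> 0" using c by (simp add: a_def[abs_def])
    \<comment> \<open>The constant \<open>c\<close> was chosen for \<open>H\<close>; the convergence
      of the iterates of \<open>v\<close> is inherited through the isometry.\<close>
    moreover have "norm (b n) = norm (a n)" for n
      using iso[OF ab ab, of n n] by (simp add: cinner_self power2_eq_iff_nonneg del: of_real_power)
    ultimately have "b \<longlonglongrightarrow> 0"
      by (simp add: tendsto_norm_zero_iff[of b, symmetric] tendsto_norm_zero)
    \<comment> \<open>Each step adds \<open>c\<close> times a pair of images under \<open>H\<close>
      and \<open>H'\<close> of pairs in \<open>V\<close>, and such pairs lie in \<open>Q\<close> by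
      \<open>HQ\<close>.\<close>
    have mem: "(u - a n, v - b n) \<in> Q" for n
    proof (induction n)
      case 0
      then show ?case using pair_subspaceD(2)[OF Q] by (simp add: a_def b_def)
    next
      case (Suc n)
      have "(u - a n + of_real c *\<^sub>C H (H (a n)), v - b n + of_real c *\<^sub>C H' (H' (b n))) \<in> Q"
        by (intro pair_subspaceD[OF Q] Suc HQ VH ab)
      then show ?case by (simp add: a_def b_def scaleR_scaleC algebra_simps)
    qed
    have "(\<lambda>n. u - a n) \<longlonglongrightarrow> u" "(\<lambda>n. v - b n) \<longlonglongrightarrow> v"
      using tendsto_diff[OF tendsto_const \<open>a \<longlonglongrightarrow> 0\<close>] tendsto_diff[OF tendsto_const \<open>b \<longlonglongrightarrow> 0\<close>] by simp_all
    then show ?thesis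
      by (rule pair_subspace_limit[OF Q]) (rule mem)
  qed
  \<comment> \<open>The squares map \<open>V\<close> into images under \<open>H\<close> and
    \<open>H'\<close>, hence into \<open>Q\<close>; only the generator needed the limit
    argument.\<close>
  have "V \<subseteq> V \<inter> Q"
    unfolding V_def
  proof (rule cyclic_pairs_least, fold V_def)
    show "pair_subspace (V \<inter> Q)" by (intro pair_subspace_Int V Q)
    show "(u, v) \<in> V \<inter> Q" using uv uvQ by simp
    show "maps_pairs (V \<inter> Q) (A \<circ> A) (A' \<circ> A')"
      using VH HQ by (auto simp: maps_pairs_def sq)
  qed
  then have VQ: "(x, y) \<in> Q" if "(x, y) \<in> V" for x y using that by blast
  show ?thesis
  proof (rule hardy_eqI)
    fix n
    have "((backward_shift ^^ n) u, (backward_shift ^^ n) v) \<in> V"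
    proof (induction n)
      case (Suc n)
      from VQ[OF this] show ?case by (simp add: Q_def)
    qed (simp add: uv)
    from VQ[OF this] show "cinner ((backward_shift ^^ n) u) hardy_one = cinner ((backward_shift ^^ n) v) hardy_one"
      by (simp add: Q_def)
  qed
qed


theorem theorem1p4:
  fixes u v :: hardy and \<rho> :: "real measure" and \<Psi> \<Psi>t :: "real \<Rightarrow> complex"
  assumes "u \<in> BMOA_simp" and "v \<in> BMOA_simp"
    and "spectral_datum u \<rho> \<Psi> \<Psi>t" and "spectral_datum v \<rho> \<Psi> \<Psi>t"
  shows "u = v"
  using assms(3,4) by (rule spectral_datum_inject)

end
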